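(* There is a universal constant $C>0$ (independent of $p$, of the sequence $\{X_k\}$ and of $\{\varphi_k\},\{\phi_k\}$) such that the following holds. Let $\{X_k\}_{k=1}^\infty$ be a sequence of centred real random variables with $\mathbb{E}X_k^2\leqslant 1$ for all $k\geqslant 1$. Let $\{\varphi_k\}_{k=1}^\infty$ be a non-increasing sequence of non-negative numbers such that, for all $i<j<k<l$, $$|\mathrm{Cov}(X_i,X_jX_kX_l)|\leqslant \varphi_{j-i},\quad |\mathrm{Cov}(X_iX_jX_k,X_l)|\leqslant \varphi_{l-k},$$ $$|\mathrm{Cov}(X_iX_j,X_kX_l)|\leqslant \varphi_{k-j},\quad |\mathrm{Cov}(X_i,X_j)|\leqslant \varphi_{j-i},$$ and let $\{\phi_k\}_{k=1}^\infty$ be a sequence of non-negative numbers such that $$\mathrm{Cov}(X_i^2,X_j^2)\leqslant \phi_{j-i}\quad\text{for all } i<j.$$ Let $\Phi_0=\sup_{k\geqslant 1}\mathbb{E}X_k^4$, $\Phi_1=\sum_{k=1}^\infty k\varphi_k$ and $\Phi_2=\sum_{k=1}^\infty \phi_k$. Then for every $p\geqslant 1$, with $\mathbf{X}_p=(X_1,\ldots,X_p)$, and all real $p\times p$ matrices $A$, $$\mathrm{Var}(\mathbf{X}_p^\top A\mathbf{X}_p)\leqslant C(\Phi_0+\Phi_1+\Phi_2)\,\mathrm{tr}(AA^\top).$$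
   Context: $\mathbf{X}_p$ is regarded as a column vector. The quantities $\Phi_0,\Phi_1,\Phi_2$ are assumed finite (if any is infinite, the bound is regarded as trivial). *)

theory Defs
  imports "HOL-Probability.Probability" "Jordan_Normal_Form.Matrix"
begin

definition mat_trace :: "'a::comm_monoid_add mat \<Rightarrow> 'a" where
  "mat_trace A = (\<Sum>i<dim_row A. A $$ (i, i))"

definition covariance :: "'a measure \<Rightarrow> ('a \<Rightarrow> real) \<Rightarrow> ('a \<Rightarrow> real) \<Rightarrow> real" where
  "covariance M U V =
     (\<integral>\<omega>. (U \<omega> - (\<integral>\<eta>. U \<eta> \<partial>M)) * (V \<omega> - (\<integral>\<eta>. V \<eta> \<partial>M)) \<partial>M)"

text \<open>
  Sequences are indexed by the positive naturals; the values at index 0 of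
  \<open>X\<close>, \<open>\<phi>\<close> and \<open>\<psi>\<close> are irrelevant and unconstrained. The sequence written
  \<open>\<psi>\<close> here bounds the covariances of the squares.
  The assumptions \<open>fourth_moment\<close>, \<open>Phi0_finite\<close>, \<open>Phi1_finite\<close> and \<open>Phi2_finite\<close> say that
  \<open>\<Phi>\<^sub>0\<close>, \<open>\<Phi>\<^sub>1\<close> and \<open>\<Phi>\<^sub>2\<close> are finite. Finite fourth moments make every covariance and
  variance below a genuine one (no integral takes its default value 0).
\<close>

locale weakly_dependent_sequence = prob_space M
  for M :: "'a measure" +
  fixes X :: "nat \<Rightarrow> 'a \<Rightarrow> real"
    and \<phi> \<psi> :: "nat \<Rightarrow> real"
  assumes rv: "\<And>k. 1 \<le> k \<Longrightarrow> random_variable borel (X k)"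
    and mean_integrable: "\<And>k. 1 \<le> k \<Longrightarrow> integrable M (X k)"
    and centred: "\<And>k. 1 \<le> k \<Longrightarrow> expectation (X k) = 0"
    and square_integrable: "\<And>k. 1 \<le> k \<Longrightarrow> integrable M (\<lambda>\<omega>. (X k \<omega>)\<^sup>2)"
    and second_moment: "\<And>k. 1 \<le> k \<Longrightarrow> expectation (\<lambda>\<omega>. (X k \<omega>)\<^sup>2) \<le> 1"
    and fourth_moment: "\<And>k. 1 \<le> k \<Longrightarrow> integrable M (\<lambda>\<omega>. X k \<omega> ^ 4)"
    and phi_nonneg: "\<And>k. 1 \<le> k \<Longrightarrow> 0 \<le> \<phi> k"
    and phi_antimono: "\<And>j k. 1 \<le> j \<Longrightarrow> j \<le> k \<Longrightarrow> \<phi> k \<le> \<phi> j"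
    and cov_1_3: "\<And>i j k l. 1 \<le> i \<Longrightarrow> i < j \<Longrightarrow> j < k \<Longrightarrow> k < l \<Longrightarrow>
      \<bar>covariance M (X i) (\<lambda>\<omega>. X j \<omega> * X k \<omega> * X l \<omega>)\<bar> \<le> \<phi> (j - i)"
    and cov_3_1: "\<And>i j k l. 1 \<le> i \<Longrightarrow> i < j \<Longrightarrow> j < k \<Longrightarrow> k < l \<Longrightarrow>
      \<bar>covariance M (\<lambda>\<omega>. X i \<omega> * X j \<omega> * X k \<omega>) (X l)\<bar> \<le> \<phi> (l - k)"
    and cov_2_2: "\<And>i j k l. 1 \<le> i \<Longrightarrow> i < j \<Longrightarrow> j < k \<Longrightarrow> k < l \<Longrightarrow>
      \<bar>covariance M (\<lambda>\<omega>. X i \<omega> * X j \<omega>) (\<lambda>\<omega>. X k \<omega> * X l \<omega>)\<bar> \<le> \<phi> (k - j)"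
    and cov_1_1: "\<And>i j. 1 \<le> i \<Longrightarrow> i < j \<Longrightarrow> \<bar>covariance M (X i) (X j)\<bar> \<le> \<phi> (j - i)"
    and psi_nonneg: "\<And>k. 1 \<le> k \<Longrightarrow> 0 \<le> \<psi> k"
    and cov_squares: "\<And>i j. 1 \<le> i \<Longrightarrow> i < j \<Longrightarrow>
      covariance M (\<lambda>\<omega>. (X i \<omega>)\<^sup>2) (\<lambda>\<omega>. (X j \<omega>)\<^sup>2) \<le> \<psi> (j - i)"
    and Phi0_finite: "bdd_above ((\<lambda>k. expectation (\<lambda>\<omega>. X k \<omega> ^ 4)) ` {1..})"
    and Phi1_finite: "summable (\<lambda>k. real (Suc k) * \<phi> (Suc k))"
    and Phi2_finite: "summable (\<lambda>k. \<psi> (Suc k))"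

definition Phi0 :: "'a measure \<Rightarrow> (nat \<Rightarrow> 'a \<Rightarrow> real) \<Rightarrow> real" where
  "Phi0 M X = (SUP k\<in>{1..}. (\<integral>\<omega>. X k \<omega> ^ 4 \<partial>M))"

definition Phi1 :: "(nat \<Rightarrow> real) \<Rightarrow> real" where
  "Phi1 \<phi> = (\<Sum>k. real (Suc k) * \<phi> (Suc k))"

definition Phi2 :: "(nat \<Rightarrow> real) \<Rightarrow> real" where
  "Phi2 \<psi> = (\<Sum>k. \<psi> (Suc k))"

text \<open>Matrix and vector indices start at 0, so the entry \<open>i\<close> of the vector is \<open>X\<^sub>i\<^sub>+\<^sub>1\<close>.\<close>

definition sample_vec :: "(nat \<Rightarrow> 'a \<Rightarrow> real) \<Rightarrow> nat \<Rightarrow> 'a \<Rightarrow> real vec" where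
  "sample_vec X p \<omega> = vec p (\<lambda>i. X (Suc i) \<omega>)"

definition quad_form :: "real mat \<Rightarrow> real vec \<Rightarrow> real" where
  "quad_form A x = scalar_prod x (A *\<^sub>v x)"

text \<open>
  \<open>variance_bound TYPE('a) C\<close>: the constant \<open>C\<close> works for all sequences on all
  probability spaces whose sample points have type \<open>'a\<close>. HOL cannot quantify over types
  inside a formula, so the universality of the constant over all probability spaces is
  expressed as follows: there is a \<open>C > 0\<close> which works for the type \<open>nat \<Rightarrow> real\<close>, and every
  \<open>C\<close> which works for \<open>nat \<Rightarrow> real\<close> works for an arbitrary type \<open>'a\<close>.
\<close>

definition variance_bound :: "'a itself \<Rightarrow> real \<Rightarrow> bool" where
  "variance_bound (_ :: 'a itself) C \<longleftrightarrow>
     (\<forall>(M :: 'a measure) X \<phi> \<psi>. weakly_dependent_sequence M X \<phi> \<psi> \<longrightarrow>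
       (\<forall>p\<ge>1. \<forall>A \<in> carrier_mat p p.
          prob_space.variance M (\<lambda>\<omega>. quad_form A (sample_vec X p \<omega>))
            \<le> C * (Phi0 M X + Phi1 \<phi> + Phi2 \<psi>) * mat_trace (A * A\<^sup>T)))"

end

theory Submission
  imports Defs
begin

text \<open>
  Write the form as its off-diagonal part, with the symmetrised coefficients
  \<open>b i j = (a i j + a j i) / 2\<close>, plus its diagonal part. The variance of a sum is at most twice the
  sum of the variances, so the two parts are treated separately; symmetrising does not increase the sum
  of the squared coefficients.

  \<^emph>\<open>Off-diagonal part.\<close> The variance is the sum of
  \<open>b i j * b k l * Cov (X\<^sub>i X\<^sub>j, X\<^sub>k X\<^sub>l)\<close>. When the four indices are distinct, the hypotheses bound the
  covariance by \<open>2 * \<phi> (max g h)\<close>, where \<open>g\<close> and \<open>h\<close> are two of the three gaps between the sorted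
  indices, chosen so that within each relative order of the indices \<open>i, j, g, h\<close> determine \<open>k\<close> and \<open>l\<close>
  (\<open>sum_abs_pair_cov_ordered\<close>). Since there are \<open>2 * m - 1\<close> pairs of positive gaps with maximum \<open>m\<close>,
  the sum over \<open>k, l\<close> is of order \<open>\<Phi>\<^sub>1\<close>, uniformly in \<open>i, j\<close>, and
  \<open>2 * \<bar>b i j * b k l\<bar> \<le> (b i j)\<^sup>2 + (b k l)\<^sup>2\<close> finishes this case.

  When the two pairs share an index, the hypotheses say nothing about the covariance of
  \<open>X\<^sub>i X\<^sub>j\<close> and \<open>X\<^sub>i X\<^sub>l\<close>. The terms with a common index \<open>i\<close> add up to the variance of \<open>X\<^sub>i S\<close>, where
  \<open>S\<close> is the linear form with coefficients \<open>b i j\<close>; this variance is at most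
  \<open>E (X\<^sub>i\<^sup>2 S\<^sup>2)\<close>, which the fourth moments of \<open>X\<^sub>i\<close> and \<open>S\<close> control (\<open>sum_shared_index_le\<close>). What is
  needed is the moment inequality
  \<open>E S\<^sup>4 \<le> (114 * \<Phi>\<^sub>0 + 96 * \<Phi>\<^sub>1) * (\<Sum>j. (b i j)\<^sup>2)\<^sup>2\<close> of \<open>linear_form_fourth_moment\<close>.
  There again products with repeated indices such as \<open>X\<^sub>i\<^sup>2 X\<^sub>j X\<^sub>k\<close> are not covered by the hypotheses;
  Newton's identities express all of them through power sums, and the pointwise inequality
  \<open>sum_pow4_le_esym4\<close> absorbs these, leaving only the fourth elementary symmetric sum, whose indices
  are distinct.

  \<^emph>\<open>Diagonal part.\<close> The covariances of the squares are bounded only from above, so signs of the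
  coefficients matter. Splitting the diagonal into its positive and its negative part gives two
  forms with non-negative coefficients, for which an upper bound on covariances suffices
  (\<open>variance_diagonal_le\<close>).

  \<^emph>\<open>The sample space.\<close> Hypotheses and conclusion depend only on the joint law of the sequence. Pushing
  the measure forward along the sequence therefore replaces an arbitrary sample space by the space
  of real sequences, with the same constant (\<open>weakly_dependent_sequence_distr\<close>).
\<close>

section \<open>Fourth powers and elementary symmetric sums\<close>

text \<open>
  The elementary symmetric polynomial of degree \<open>m\<close> in \<open>x 0, \<dots>, x (n - 1)\<close>, as a nested sum over
  decreasing indices. Splitting off the largest index makes Newton's identities provable by
  induction on \<open>n\<close>, and the sum runs over sorted indices, as the covariance hypotheses do.
\<close>

fun esym :: "nat \<Rightarrow> (nat \<Rightarrow> real) \<Rightarrow> nat \<Rightarrow> real" where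
  "esym 0 x n = 1"
| "esym (Suc m) x n = (\<Sum>k<n. x k * esym m x k)"

lemma newton_esym2: "2 * esym 2 x n = (\<Sum>k<n. x k)^2 - (\<Sum>k<n. (x k)^2)"
  by (induction n) (auto simp: numeral_eq_Suc algebra_simps)

lemma newton_esym3:
  "6 * esym 3 x n = (\<Sum>k<n. x k)^3 - 3 * (\<Sum>k<n. x k) * (\<Sum>k<n. (x k)^2) + 2 * (\<Sum>k<n. x k ^ 3)"
proof (induction n)
  case 0 show ?case by (simp add: numeral_eq_Suc)
next
  case (Suc n)
  have "6 * esym 3 x (Suc n) = 6 * esym 3 x n + 3 * x n * (2 * esym 2 x n)"
    by (simp add: numeral_eq_Suc algebra_simps)
  then show ?case unfolding Suc.IH newton_esym2
    by (simp add: algebra_simps power2_eq_square power3_eq_cube)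
qed

lemma newton_esym4:
  "24 * esym 4 x n = (\<Sum>k<n. x k)^4 - 6 * (\<Sum>k<n. x k)^2 * (\<Sum>k<n. (x k)^2)
     + 3 * (\<Sum>k<n. (x k)^2)^2 + 8 * (\<Sum>k<n. x k) * (\<Sum>k<n. x k ^ 3) - 6 * (\<Sum>k<n. x k ^ 4)"
proof (induction n)
  case 0 show ?case by (simp add: numeral_eq_Suc)
next
  case (Suc n)
  have "24 * esym 4 x (Suc n) = 24 * esym 4 x n + 4 * x n * (6 * esym 3 x n)"
    by (simp add: numeral_eq_Suc algebra_simps)
  then show ?case unfolding Suc.IH newton_esym3
    by (simp add: algebra_simps power2_eq_square power3_eq_cube power4_eq_xxxx)
qed

text \<open>
  By Newton's identity the fourth power of the sum is \<open>24 * esym 4 x n\<close> plus terms with repeated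
  indices. These are products of the power sums \<open>P1, \<dots>, P4\<close>; the ones that contain \<open>P1\<close> are absorbed
  by \<open>P1\<^sup>4 / 2\<close> at the cost of multiples of \<open>P4\<close> and \<open>P2\<^sup>2\<close>, and \<open>P4 \<le> P2\<^sup>2\<close>.
\<close>

lemma sum_pow4_le_esym4:
  "(\<Sum>k<n. x k)^4 \<le> 48 * esym 4 x n + 114 * (\<Sum>k<n. (x k)^2)^2"
proof -
  define P1 where "P1 = (\<Sum>k<n. x k)"
  define P2 where "P2 = (\<Sum>k<n. (x k)^2)"
  define P3 where "P3 = (\<Sum>k<n. x k ^ 3)"
  define P4 where "P4 = (\<Sum>k<n. x k ^ 4)"
  have N: "24 * esym 4 x n = P1^4 - 6 * P1^2 * P2 + 3 * P2^2 + 8 * P1 * P3 - 6 * P4"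
    unfolding P1_def P2_def P3_def P4_def by (rule newton_esym4)
  have "- 8 * P1 * P3 = (\<Sum>k<n. - 8 * P1 * x k * (x k)^2)"
    unfolding P3_def by (simp add: sum_distrib_left power2_eq_square power3_eq_cube algebra_simps)
  also have "\<dots> \<le> (\<Sum>k<n. 4 * P1^2 * (x k)^2 + 4 * x k^4)"
  proof (rule sum_mono)
    fix k
    have "0 \<le> 4 * (P1 * x k + (x k)^2)^2" by simp
    then show "- 8 * P1 * x k * (x k)^2 \<le> 4 * P1^2 * (x k)^2 + 4 * x k^4"
      by (simp add: power2_eq_square power4_eq_xxxx algebra_simps)
  qed
  also have "\<dots> = 4 * P1^2 * P2 + 4 * P4"
    by (simp add: P2_def P4_def sum.distrib sum_distrib_left)
  finally have 3: "- 8 * P1 * P3 \<le> 4 * P1^2 * P2 + 4 * P4" .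
  have "P4 = (\<Sum>k<n. (x k)^2 * (x k)^2)"
    by (simp add: P4_def power2_eq_square power4_eq_xxxx algebra_simps)
  also have "\<dots> \<le> (\<Sum>k<n. (x k)^2 * P2)"
    unfolding P2_def by (intro sum_mono mult_left_mono member_le_sum) auto
  also have "\<dots> = P2^2"
    by (simp add: P2_def power2_eq_square sum_distrib_right)
  finally have 4: "P4 \<le> P2^2" .
  \<comment> \<open>The terms \<open>6 * P1\<^sup>2 * P2\<close> and \<open>4 * P1\<^sup>2 * P2\<close> add up to \<open>10 * P1\<^sup>2 * P2\<close>; half of \<open>P1\<^sup>4\<close> absorbs them.\<close>
  have "0 \<le> (P1^2 - 10 * P2)^2" by simp
  then have "20 * P1^2 * P2 \<le> P1^4 + 100 * P2^2"
    by (simp add: power2_eq_square power4_eq_xxxx algebra_simps)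
  with N 3 4 show ?thesis
    unfolding P1_def[symmetric] P2_def[symmetric] by linarith
qed

lemma abs_prod4_le: "\<bar>a * b * (c * d)\<bar> \<le> a^4 + b^4 + c^4 + (d::real)^4"
proof -
  have "\<bar>a * b * (c * d)\<bar> \<le> (a*b)^2 + (c*d)^2"
  proof -
    have "0 \<le> (\<bar>a * b\<bar> - \<bar>c * d\<bar>)^2" "0 \<le> \<bar>a * b\<bar> * \<bar>c * d\<bar>" by simp_all
    moreover have "(\<bar>a * b\<bar> - \<bar>c * d\<bar>)^2 = (a*b)^2 + (c*d)^2 - 2 * (\<bar>a * b\<bar> * \<bar>c * d\<bar>)"
      by (simp add: power2_diff)
    ultimately show ?thesis unfolding abs_mult[of "a * b"] by linarith
  qed
  moreover have "(a*b)^2 \<le> a^4 + b^4" "(c*d)^2 \<le> c^4 + d^4"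
  proof -
    have "(x*y)^2 \<le> x^4 + y^4" for x y :: real
    proof -
      have "0 \<le> (x^2 - y^2)^2" "0 \<le> (x*y)^2" by simp_all
      moreover have "(x^2 - y^2)^2 = x^4 + y^4 - 2 * (x*y)^2"
        by (simp add: power2_diff power_mult_distrib)
      ultimately show ?thesis by linarith
    qed
    then show "(a*b)^2 \<le> a^4 + b^4" "(c*d)^2 \<le> c^4 + d^4" by blast+
  qed
  ultimately show ?thesis by linarith
qed

section \<open>Rearranging quadruple sums\<close>

text \<open>
  The order of summation on the right groups \<open>j, l\<close> and \<open>i, k\<close>, the pairs that are kept together in
  \<open>ordered_m4_sum_le\<close>; the non-negativity of \<open>h\<close> pays for the enlarged range.
\<close>

lemma ordered_sum_le:
  fixes f h :: "nat \<Rightarrow> nat \<Rightarrow> nat \<Rightarrow> nat \<Rightarrow> real"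
  assumes le: "\<And>i j k l. i < j \<Longrightarrow> j < k \<Longrightarrow> k < l \<Longrightarrow> l < n \<Longrightarrow> f i j k l \<le> h i j k l"
    and nn: "\<And>i j k l. 0 \<le> h i j k l"
  shows "(\<Sum>l<n. \<Sum>k<l. \<Sum>j<k. \<Sum>i<j. f i j k l) \<le> (\<Sum>l<n. \<Sum>j<n. \<Sum>k<n. \<Sum>i<n. h i j k l)"
proof -
  have ext: "(\<Sum>i<m. g i) \<le> (\<Sum>i<n. g i)" if "m \<le> n" "\<And>i. 0 \<le> g i" for m and g :: "nat \<Rightarrow> real"
    using that by (intro sum_mono2) auto
  have "(\<Sum>l<n. \<Sum>k<l. \<Sum>j<k. \<Sum>i<j. f i j k l) \<le> (\<Sum>l<n. \<Sum>k<l. \<Sum>j<k. \<Sum>i<j. h i j k l)"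
    by (intro sum_mono le) auto
  also have "\<dots> \<le> (\<Sum>l<n. \<Sum>k<l. \<Sum>j<k. \<Sum>i<n. h i j k l)"
    by (intro sum_mono ext nn) auto
  also have "\<dots> \<le> (\<Sum>l<n. \<Sum>k<l. \<Sum>j<n. \<Sum>i<n. h i j k l)"
    by (intro sum_mono ext nn sum_nonneg) auto
  also have "\<dots> \<le> (\<Sum>l<n. \<Sum>k<n. \<Sum>j<n. \<Sum>i<n. h i j k l)"
    by (intro sum_mono ext nn sum_nonneg) auto
  also have "\<dots> = (\<Sum>l<n. \<Sum>j<n. \<Sum>k<n. \<Sum>i<n. h i j k l)"
    by (rule sum.cong[OF refl], rule sum.swap)
  finally show ?thesis .
qed

lemma sum_swap_pairs:
  "(\<Sum>i\<in>A. \<Sum>j\<in>B. \<Sum>k\<in>C. \<Sum>l\<in>D. f i j k l) = (\<Sum>k\<in>C. \<Sum>l\<in>D. \<Sum>i\<in>A. \<Sum>j\<in>B. f i j k l)"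
  for f :: "_ \<Rightarrow> _ \<Rightarrow> _ \<Rightarrow> _ \<Rightarrow> real"
proof -
  have rot: "(\<Sum>i\<in>A. \<Sum>j\<in>B. \<Sum>k\<in>K. g i j k) = (\<Sum>k\<in>K. \<Sum>i\<in>A. \<Sum>j\<in>B. g i j k)"
    for K and g :: "_ \<Rightarrow> _ \<Rightarrow> _ \<Rightarrow> real"
  proof -
    have "(\<Sum>i\<in>A. \<Sum>j\<in>B. \<Sum>k\<in>K. g i j k) = (\<Sum>i\<in>A. \<Sum>k\<in>K. \<Sum>j\<in>B. g i j k)"
      by (rule sum.cong[OF refl], rule sum.swap)
    also have "\<dots> = (\<Sum>k\<in>K. \<Sum>i\<in>A. \<Sum>j\<in>B. g i j k)" by (rule sum.swap)
    finally show ?thesis .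
  qed
  show ?thesis by (subst rot) (rule sum.cong[OF refl], rule rot)
qed

text \<open>
  Inclusion-exclusion over the coincidences \<open>k = i\<close>, \<open>k = j\<close>, \<open>l = i\<close>, \<open>l = j\<close>. At most two of them
  hold at once, because \<open>b\<close> vanishes on the diagonal, and then \<open>{k, l} = {i, j}\<close>. By symmetry the
  four single coincidences contribute equally, and so do the two double ones.
\<close>

lemma sum_pairs_split:
  fixes b :: "nat \<Rightarrow> nat \<Rightarrow> real" and K :: "nat \<Rightarrow> nat \<Rightarrow> nat \<Rightarrow> nat \<Rightarrow> real"
  assumes I: "finite I"
    and sym: "\<And>i j. b i j = b j i" and diag: "\<And>i. b i i = 0"
    and K1: "\<And>i j k l. K i j k l = K j i k l" and K2: "\<And>i j k l. K i j k l = K i j l k"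
  shows "(\<Sum>i\<in>I. \<Sum>j\<in>I. \<Sum>k\<in>I. \<Sum>l\<in>I. b i j * b k l * K i j k l)
    = (\<Sum>i\<in>I. \<Sum>j\<in>I. \<Sum>k\<in>I. \<Sum>l\<in>I.
         if k \<notin> {i,j} \<and> l \<notin> {i,j} then b i j * b k l * K i j k l else 0)
      + 4 * (\<Sum>i\<in>I. \<Sum>j\<in>I. \<Sum>l\<in>I. b i j * b i l * K i j i l)
      - 2 * (\<Sum>i\<in>I. \<Sum>j\<in>I. (b i j)^2 * K i j i j)"
    (is "?L = ?D + 4 * ?T - 2 * ?S")
proof -
  let ?F = "\<lambda>i j k l. b i j * b k l * K i j k l"
  have pt: "?F i j k l = (if k \<notin> {i,j} \<and> l \<notin> {i,j} then ?F i j k l else 0)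
     + (if k = i then ?F i j i l else 0) + (if k = j then ?F i j j l else 0)
     + (if l = i then ?F i j k i else 0) + (if l = j then ?F i j k j else 0)
     - (if k = i then if l = j then ?F i j i j else 0 else 0)
     - (if k = j then if l = i then ?F i j j i else 0 else 0)" for i j k l
    by (cases "i = j \<or> k = l") (auto simp: diag)
  have s1: "(\<Sum>i\<in>I. \<Sum>j\<in>I. \<Sum>k\<in>I. \<Sum>l\<in>I. if k = i then ?F i j i l else 0) = ?T"
  proof (rule sum.cong[OF refl], rule sum.cong[OF refl])
    fix i j assume "i \<in> I" "j \<in> I"
    have "(\<Sum>k\<in>I. \<Sum>l\<in>I. if k = i then ?F i j i l else 0)
        = (\<Sum>k\<in>I. if k = i then \<Sum>l\<in>I. ?F i j i l else 0)" by (intro sum.cong) auto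
    then show "(\<Sum>k\<in>I. \<Sum>l\<in>I. if k = i then ?F i j i l else 0) = (\<Sum>l\<in>I. ?F i j i l)"
      using I \<open>i \<in> I\<close> by simp
  qed
  have s2: "(\<Sum>i\<in>I. \<Sum>j\<in>I. \<Sum>k\<in>I. \<Sum>l\<in>I. if k = j then ?F i j j l else 0) = ?T"
  proof -
    have "(\<Sum>i\<in>I. \<Sum>j\<in>I. \<Sum>k\<in>I. \<Sum>l\<in>I. if k = j then ?F i j j l else 0)
       = (\<Sum>i\<in>I. \<Sum>j\<in>I. \<Sum>l\<in>I. ?F i j j l)"
    proof (rule sum.cong[OF refl], rule sum.cong[OF refl])
      fix i j assume "i \<in> I" "j \<in> I"
      have "(\<Sum>k\<in>I. \<Sum>l\<in>I. if k = j then ?F i j j l else 0)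
          = (\<Sum>k\<in>I. if k = j then \<Sum>l\<in>I. ?F i j j l else 0)" by (intro sum.cong) auto
      then show "(\<Sum>k\<in>I. \<Sum>l\<in>I. if k = j then ?F i j j l else 0) = (\<Sum>l\<in>I. ?F i j j l)"
        using I \<open>j \<in> I\<close> by simp
    qed
    also have "\<dots> = (\<Sum>i\<in>I. \<Sum>j\<in>I. \<Sum>l\<in>I. ?F j i i l)" by (rule sum.swap)
    also have "\<dots> = ?T" by (intro sum.cong refl) (metis K1 sym)
    finally show ?thesis .
  qed
  have s3: "(\<Sum>i\<in>I. \<Sum>j\<in>I. \<Sum>k\<in>I. \<Sum>l\<in>I. if l = i then ?F i j k i else 0) = ?T"
    using I by (intro sum.cong[OF refl]) (simp add: K2 sym)
  have s4: "(\<Sum>i\<in>I. \<Sum>j\<in>I. \<Sum>k\<in>I. \<Sum>l\<in>I. if l = j then ?F i j k j else 0) = ?T"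
  proof -
    have "(\<Sum>i\<in>I. \<Sum>j\<in>I. \<Sum>k\<in>I. \<Sum>l\<in>I. if l = j then ?F i j k j else 0)
       = (\<Sum>i\<in>I. \<Sum>j\<in>I. \<Sum>k\<in>I. ?F i j k j)" using I by (intro sum.cong refl) simp
    also have "\<dots> = (\<Sum>i\<in>I. \<Sum>j\<in>I. \<Sum>k\<in>I. ?F j i k i)" by (rule sum.swap)
    also have "\<dots> = ?T" by (intro sum.cong refl) (metis K1 K2 sym)
    finally show ?thesis .
  qed
  have s5: "(\<Sum>i\<in>I. \<Sum>j\<in>I. \<Sum>k\<in>I. \<Sum>l\<in>I.
      if k = i then if l = j then ?F i j i j else 0 else 0) = ?S"
  proof (rule sum.cong[OF refl], rule sum.cong[OF refl])
    fix i j assume "i \<in> I" "j \<in> I"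
    have "(\<Sum>k\<in>I. \<Sum>l\<in>I. if k = i then if l = j then ?F i j i j else 0 else 0)
        = (\<Sum>k\<in>I. if k = i then \<Sum>l\<in>I. if l = j then ?F i j i j else 0 else 0)"
      by (intro sum.cong) auto
    then show "(\<Sum>k\<in>I. \<Sum>l\<in>I. if k = i then if l = j then ?F i j i j else 0 else 0)
        = (b i j)^2 * K i j i j"
      using I \<open>i \<in> I\<close> \<open>j \<in> I\<close> by (simp add: power2_eq_square)
  qed
  have s6: "(\<Sum>i\<in>I. \<Sum>j\<in>I. \<Sum>k\<in>I. \<Sum>l\<in>I.
      if k = j then if l = i then ?F i j j i else 0 else 0) = ?S"
  proof (rule sum.cong[OF refl], rule sum.cong[OF refl])
    fix i j assume "i \<in> I" "j \<in> I"
    have "(\<Sum>k\<in>I. \<Sum>l\<in>I. if k = j then if l = i then ?F i j j i else 0 else 0)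
        = (\<Sum>k\<in>I. if k = j then \<Sum>l\<in>I. if l = i then ?F i j j i else 0 else 0)"
      by (intro sum.cong) auto
    then show "(\<Sum>k\<in>I. \<Sum>l\<in>I. if k = j then if l = i then ?F i j j i else 0 else 0)
        = (b i j)^2 * K i j i j"
      using I \<open>i \<in> I\<close> \<open>j \<in> I\<close> K2[of i j i j] sym[of i j] by (simp add: power2_eq_square)
  qed
  have "?L = (\<Sum>i\<in>I. \<Sum>j\<in>I. \<Sum>k\<in>I. \<Sum>l\<in>I.
      (if k \<notin> {i,j} \<and> l \<notin> {i,j} then ?F i j k l else 0)
     + (if k = i then ?F i j i l else 0) + (if k = j then ?F i j j l else 0)
     + (if l = i then ?F i j k i else 0) + (if l = j then ?F i j k j else 0)
     - (if k = i then if l = j then ?F i j i j else 0 else 0)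
     - (if k = j then if l = i then ?F i j j i else 0 else 0))"
    by (intro sum.cong refl) (rule pt)
  also have "\<dots> = ?D + ?T + ?T + ?T + ?T - ?S - ?S"
    unfolding sum.distrib sum_subtractf s1 s2 s3 s4 s5 s6 ..
  finally show ?thesis by simp
qed

context weakly_dependent_sequence
begin

section \<open>Moments and covariances of products\<close>

text \<open>
  Vectors and matrices are indexed from 0, the sequence from 1. After the shift every index is
  admissible, and gaps between indices are unchanged.
\<close>

abbreviation Y :: "nat \<Rightarrow> 'a \<Rightarrow> real" where "Y i \<equiv> X (Suc i)"

definition m2 :: "nat \<Rightarrow> nat \<Rightarrow> real" where
  "m2 i j = expectation (\<lambda>\<omega>. Y i \<omega> * Y j \<omega>)"

definition m4 :: "nat \<Rightarrow> nat \<Rightarrow> nat \<Rightarrow> nat \<Rightarrow> real" where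
  "m4 i j k l = expectation (\<lambda>\<omega>. Y i \<omega> * Y j \<omega> * (Y k \<omega> * Y l \<omega>))"

definition pair_cov :: "nat \<Rightarrow> nat \<Rightarrow> nat \<Rightarrow> nat \<Rightarrow> real" where
  "pair_cov i j k l = m4 i j k l - m2 i j * m2 k l"

lemma Y_measurable [measurable]: "Y i \<in> borel_measurable M"
  by (rule rv) simp

lemma integrable_pow4: "integrable M (\<lambda>\<omega>. Y i \<omega> ^ 4)"
  by (rule fourth_moment) simp

lemma integrable_prod4: "integrable M (\<lambda>\<omega>. Y i \<omega> * Y j \<omega> * (Y k \<omega> * Y l \<omega>))"
proof (rule Bochner_Integration.integrable_bound)
  show "integrable M (\<lambda>\<omega>. Y i \<omega>^4 + Y j \<omega>^4 + Y k \<omega>^4 + Y l \<omega>^4)"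
    by (intro Bochner_Integration.integrable_add integrable_pow4)
qed (use abs_prod4_le in \<open>auto intro!: AE_I2 order_trans[OF abs_prod4_le]\<close>)

lemma integrable_prod3: "integrable M (\<lambda>\<omega>. Y i \<omega> * Y j \<omega> * Y k \<omega>)"
proof (rule Bochner_Integration.integrable_bound)
  show "integrable M (\<lambda>\<omega>. Y i \<omega>^4 + Y j \<omega>^4 + Y k \<omega>^4 + 1^4)"
    by (intro Bochner_Integration.integrable_add integrable_pow4) simp
  show "AE \<omega> in M. norm (Y i \<omega> * Y j \<omega> * Y k \<omega>) \<le> norm (Y i \<omega>^4 + Y j \<omega>^4 + Y k \<omega>^4 + 1^4)"
    using abs_prod4_le[of _ _ _ 1] by (auto simp: abs_mult intro!: AE_I2)
qed simp

lemma integrable_prod2: "integrable M (\<lambda>\<omega>. Y i \<omega> * Y j \<omega>)"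
proof (rule Bochner_Integration.integrable_bound)
  show "integrable M (\<lambda>\<omega>. Y i \<omega>^4 + Y j \<omega>^4 + 1^4 + 1^4)"
    by (intro Bochner_Integration.integrable_add integrable_pow4) simp_all
  show "AE \<omega> in M. norm (Y i \<omega> * Y j \<omega>) \<le> norm (Y i \<omega>^4 + Y j \<omega>^4 + 1^4 + 1^4)"
    using abs_prod4_le[of _ _ 1 1] by (auto simp: abs_mult intro!: AE_I2)
qed simp

lemma integrable_Y: "integrable M (Y i)"
  by (rule mean_integrable) simp

lemma covariance_eq:
  assumes "integrable M U" "integrable M V" "integrable M (\<lambda>\<omega>. U \<omega> * V \<omega>)"
  shows "covariance M U V = expectation (\<lambda>\<omega>. U \<omega> * V \<omega>) - expectation U * expectation V"
proof -
  have "covariance M U V = expectation (\<lambda>\<omega>. U \<omega> * V \<omega> - expectation U * V \<omega>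
      - expectation V * U \<omega> + expectation U * expectation V)"
    unfolding covariance_def by (simp add: algebra_simps)
  also have "\<dots> = expectation (\<lambda>\<omega>. U \<omega> * V \<omega>) - expectation U * expectation V"
    using assms by (simp add: prob_space)
  finally show ?thesis .
qed

lemma m2_commute: "m2 i j = m2 j i"
  by (simp add: m2_def mult.commute)

lemma m4_swap: "m4 i j k l = m4 j i k l" "m4 i j k l = m4 i j l k"
  "m4 i j k l = m4 k l i j"
  by (simp_all add: m4_def mult.commute mult.left_commute mult.assoc)

lemma pair_cov_swap: "pair_cov i j k l = pair_cov j i k l" "pair_cov i j k l = pair_cov i j l k"
  "pair_cov i j k l = pair_cov k l i j"
proof -
  show "pair_cov i j k l = pair_cov j i k l"
    unfolding pair_cov_def m4_swap(1)[of i j] m2_commute[of i j] ..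
  show "pair_cov i j k l = pair_cov i j l k"
    unfolding pair_cov_def m4_swap(2)[of i j k l] m2_commute[of k l] ..
  show "pair_cov i j k l = pair_cov k l i j"
    unfolding pair_cov_def m4_swap(3)[of i j k l] mult.commute[of "m2 i j"] ..
qed

text \<open>
  With this bound a product of two covariances is at most one value of \<open>\<phi>\<close>, not a product of two, so
  that the final estimate is linear in \<open>\<Phi>\<^sub>1\<close>.
\<close>

lemma abs_m2_le_1: "\<bar>m2 i j\<bar> \<le> 1"
proof -
  have sq: "expectation (\<lambda>\<omega>. Y i \<omega> * Y i \<omega>) \<le> 1" for i
    using second_moment[of "Suc i"] by (simp add: power2_eq_square)
  have "\<bar>m2 i j\<bar> \<le> expectation (\<lambda>\<omega>. \<bar>Y i \<omega> * Y j \<omega>\<bar>)"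
    unfolding m2_def by (rule integral_abs_bound)
  also have "\<dots> \<le> expectation (\<lambda>\<omega>. (Y i \<omega> * Y i \<omega> + Y j \<omega> * Y j \<omega>) / 2)"
  proof (rule integral_mono)
    fix \<omega>
    show "\<bar>Y i \<omega> * Y j \<omega>\<bar> \<le> (Y i \<omega> * Y i \<omega> + Y j \<omega> * Y j \<omega>) / 2"
      using sum_squares_bound[of "\<bar>Y i \<omega>\<bar>" "\<bar>Y j \<omega>\<bar>"] by (simp add: abs_mult power2_eq_square)
  qed (auto intro!: integrable_prod2)
  also have "\<dots> \<le> 1"
    using sq[of i] sq[of j] by (simp add: integrable_prod2)
  finally show ?thesis .
qed

lemma abs_m2_le_phi: assumes "i < j" shows "\<bar>m2 i j\<bar> \<le> \<phi> (j - i)"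
  using cov_1_1[of "Suc i" "Suc j"] assms
  by (simp add: covariance_eq integrable_Y integrable_prod2 centred m2_def)

lemma abs_m2_mult_le:
  assumes "i < j" "i' < j'"
  shows "\<bar>m2 i j * m2 i' j'\<bar> \<le> \<phi> (j - i)" "\<bar>m2 i j * m2 i' j'\<bar> \<le> \<phi> (j' - i')"
proof -
  show "\<bar>m2 i j * m2 i' j'\<bar> \<le> \<phi> (j - i)"
    using mult_mono[OF abs_m2_le_phi[OF assms(1)] abs_m2_le_1[of i' j']] phi_nonneg[of "j - i"] assms
    by (simp add: abs_mult)
  show "\<bar>m2 i j * m2 i' j'\<bar> \<le> \<phi> (j' - i')"
    using mult_mono[OF abs_m2_le_1[of i j] abs_m2_le_phi[OF assms(2)]] phi_nonneg[of "j - i"] assms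
    by (simp add: abs_mult)
qed

lemma abs_m4_le_phi:
  assumes "i < j" "j < k" "k < l"
  shows "\<bar>m4 i j k l\<bar> \<le> \<phi> (j - i)" "\<bar>m4 i j k l\<bar> \<le> \<phi> (l - k)"
proof -
  have "\<bar>covariance M (Y i) (\<lambda>\<omega>. Y j \<omega> * Y k \<omega> * Y l \<omega>)\<bar> \<le> \<phi> (Suc j - Suc i)"
    using assms by (intro cov_1_3) auto
  moreover have "covariance M (Y i) (\<lambda>\<omega>. Y j \<omega> * Y k \<omega> * Y l \<omega>) = m4 i j k l"
    using integrable_prod4[of i j k l]
    by (subst covariance_eq) (simp_all add: integrable_Y integrable_prod3[unfolded mult.assoc] centred m4_def mult.assoc)
  ultimately show "\<bar>m4 i j k l\<bar> \<le> \<phi> (j - i)" by simp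
  have "\<bar>covariance M (\<lambda>\<omega>. Y i \<omega> * Y j \<omega> * Y k \<omega>) (Y l)\<bar> \<le> \<phi> (Suc l - Suc k)"
    using assms by (intro cov_3_1) auto
  moreover have "covariance M (\<lambda>\<omega>. Y i \<omega> * Y j \<omega> * Y k \<omega>) (Y l) = m4 i j k l"
    using integrable_prod4[of i j k l]
    by (subst covariance_eq) (simp_all add: integrable_Y integrable_prod3[unfolded mult.assoc] centred m4_def mult.assoc)
  ultimately show "\<bar>m4 i j k l\<bar> \<le> \<phi> (l - k)" by simp
qed

lemma abs_pair_cov_le_phi:
  assumes "i < j" "j < k" "k < l"
  shows "\<bar>pair_cov i j k l\<bar> \<le> \<phi> (k - j)"
proof -
  have "\<bar>covariance M (\<lambda>\<omega>. Y i \<omega> * Y j \<omega>) (\<lambda>\<omega>. Y k \<omega> * Y l \<omega>)\<bar> \<le> \<phi> (Suc k - Suc j)"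
    using assms by (intro cov_2_2) auto
  moreover have "covariance M (\<lambda>\<omega>. Y i \<omega> * Y j \<omega>) (\<lambda>\<omega>. Y k \<omega> * Y l \<omega>) = pair_cov i j k l"
    by (subst covariance_eq) (simp_all add: integrable_prod2 integrable_prod4 pair_cov_def m4_def m2_def)
  ultimately show ?thesis by simp
qed

text \<open>
  For separated pairs \<open>i < j < k < l\<close> all three gaps are available: the middle one by hypothesis, the
  outer ones by bounding the mixed moment and the product of second moments individually.
\<close>

lemma abs_pair_cov_separated:
  assumes "i < j" "j < k" "k < l"
  shows "\<bar>pair_cov i j k l\<bar> \<le> 2 * \<phi> (max (k - j) (l - k))"
    and "\<bar>pair_cov i j k l\<bar> \<le> 2 * \<phi> (max (j - i) (k - j))"
proof -
  have "\<bar>pair_cov i j k l\<bar> \<le> 2 * \<phi> (l - k)" "\<bar>pair_cov i j k l\<bar> \<le> 2 * \<phi> (j - i)"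
    using abs_m4_le_phi[OF assms] abs_m2_mult_le[OF assms(1,3)]
    unfolding pair_cov_def by (auto simp: abs_le_iff)
  moreover have "\<bar>pair_cov i j k l\<bar> \<le> 2 * \<phi> (k - j)"
    using abs_pair_cov_le_phi[OF assms] phi_nonneg[of "k - j"] assms by simp
  ultimately show "\<bar>pair_cov i j k l\<bar> \<le> 2 * \<phi> (max (k - j) (l - k))"
    and "\<bar>pair_cov i j k l\<bar> \<le> 2 * \<phi> (max (j - i) (k - j))" by (auto simp: max_def)
qed

text \<open>
  For interleaved or nested pairs only the outer gaps are available: the mixed moment need not be
  small when the middle gap is large.
\<close>

lemma abs_pair_cov_crossing:
  assumes "i < j" "j < k" "k < l"
  shows "\<bar>pair_cov i k j l\<bar> \<le> 2 * \<phi> (max (j - i) (l - k))"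
    and "\<bar>pair_cov i l j k\<bar> \<le> 2 * \<phi> (max (j - i) (l - k))"
proof -
  have e: "m4 i k j l = m4 i j k l" "m4 i l j k = m4 i j k l"
    by (simp_all add: m4_def ac_simps)
  have mono: "\<phi> (k - i) \<le> \<phi> (j - i)" "\<phi> (l - i) \<le> \<phi> (j - i)"
     "\<phi> (l - j) \<le> \<phi> (l - k)" "\<phi> (l - i) \<le> \<phi> (l - k)"
    using assms by (auto intro!: phi_antimono)
  have m: "\<bar>m2 i k * m2 j l\<bar> \<le> \<phi> (k - i)" "\<bar>m2 i k * m2 j l\<bar> \<le> \<phi> (l - j)"
     "\<bar>m2 i l * m2 j k\<bar> \<le> \<phi> (l - i)"
    using assms by (auto intro!: abs_m2_mult_le)
  have "\<bar>pair_cov i k j l\<bar> \<le> 2 * \<phi> (j - i)" "\<bar>pair_cov i k j l\<bar> \<le> 2 * \<phi> (l - k)"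
    "\<bar>pair_cov i l j k\<bar> \<le> 2 * \<phi> (j - i)" "\<bar>pair_cov i l j k\<bar> \<le> 2 * \<phi> (l - k)"
    using abs_m4_le_phi[OF assms] m mono unfolding pair_cov_def e by linarith+
  then show "\<bar>pair_cov i k j l\<bar> \<le> 2 * \<phi> (max (j - i) (l - k))"
    and "\<bar>pair_cov i l j k\<bar> \<le> 2 * \<phi> (max (j - i) (l - k))"
    unfolding max_def by simp_all
qed

lemma Phi1_nonneg: "0 \<le> Phi1 \<phi>"
  unfolding Phi1_def by (intro suminf_nonneg Phi1_finite mult_nonneg_nonneg phi_nonneg) auto

text \<open>
  Exactly \<open>2 * m - 1\<close> pairs of positive integers have maximum \<open>m\<close>, so the sum of \<open>\<phi> (max g h)\<close> over all
  such pairs is at most twice \<open>\<Sum>m. m * \<phi> m\<close>. The injection \<open>d\<close> records the two gaps by which the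
  elements of an index set are determined.
\<close>

lemma sum_phi_max_le:
  assumes T: "finite T" and inj: "inj_on d T"
    and pos: "\<And>t. t \<in> T \<Longrightarrow> 1 \<le> fst (d t) \<and> 1 \<le> snd (d t)"
  shows "(\<Sum>t\<in>T. \<phi> (max (fst (d t)) (snd (d t)))) \<le> 2 * Phi1 \<phi>"
proof -
  have box: "(\<Sum>a=1..N. \<Sum>b=1..N. \<phi> (max a b)) = (\<Sum>m=1..N. (2 * real m - 1) * \<phi> m)" for N
  proof (induction N)
    case (Suc N)
    have "(\<Sum>a=1..N. \<phi> (max a (Suc N))) = (\<Sum>a=1..N. \<phi> (Suc N))"
         "(\<Sum>b=1..N. \<phi> (max (Suc N) b)) = (\<Sum>b=1..N. \<phi> (Suc N))"
      by (intro sum.cong; simp add: max_def)+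
    with Suc show ?case by (simp add: sum.distrib algebra_simps)
  qed simp
  define N where "N = Max (insert 0 (fst ` d ` T \<union> snd ` d ` T))"
  have "d ` T \<subseteq> {1..N} \<times> {1..N}"
  proof (intro subsetI)
    fix z assume "z \<in> d ` T"
    then obtain t where t: "t \<in> T" "z = d t" by auto
    have "fst (d t) \<le> N" "snd (d t) \<le> N"
      unfolding N_def using T t by (auto intro!: Max_ge)
    then show "z \<in> {1..N} \<times> {1..N}" using pos[OF t(1)] t(2) by (simp add: mem_Times_iff)
  qed
  then have "(\<Sum>z\<in>d ` T. \<phi> (max (fst z) (snd z))) \<le> (\<Sum>z\<in>{1..N}\<times>{1..N}. \<phi> (max (fst z) (snd z)))"
    by (intro sum_mono2) (auto intro!: phi_nonneg)
  also have "\<dots> = (\<Sum>m=1..N. (2 * real m - 1) * \<phi> m)"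
    unfolding box[symmetric] by (simp add: sum.cartesian_product case_prod_beta)
  also have "\<dots> \<le> (\<Sum>m=1..N. 2 * (real m * \<phi> m))"
    by (intro sum_mono) (auto simp: algebra_simps intro!: phi_nonneg)
  also have "\<dots> = 2 * (\<Sum>m<N. real (Suc m) * \<phi> (Suc m))"
    unfolding sum_distrib_left[symmetric]
    by (simp only: sum.atLeast1_atMost_eq One_nat_def)
  also have "\<dots> \<le> 2 * Phi1 \<phi>"
    unfolding Phi1_def
    by (intro mult_left_mono sum_le_suminf Phi1_finite) (auto intro!: phi_nonneg mult_nonneg_nonneg)
  finally show ?thesis using inj by (simp add: sum.reindex)
qed

text \<open>
  There are six relative orders of \<open>i < j\<close> and \<open>k < l\<close>. In each of them the covariance is controlled
  by two gaps that determine \<open>k\<close> and \<open>l\<close> once \<open>i\<close> and \<open>j\<close> are given, so that \<open>sum_phi_max_le\<close>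
  applies; this yields six sums of size at most \<open>2 * 2 * \<Phi>\<^sub>1\<close>.
\<close>

lemma sum_abs_pair_cov_ordered:
  assumes "i < j"
  shows "(\<Sum>(k,l)\<in>{(k,l). k < l \<and> l < n \<and> k \<notin> {i,j} \<and> l \<notin> {i,j}}. \<bar>pair_cov i j k l\<bar>) \<le> 24 * Phi1 \<phi>"
proof -
  let ?T = "{(k,l). k < l \<and> l < n \<and> k \<notin> {i,j} \<and> l \<notin> {i,j}}"
  have fin: "finite ?T"
    by (rule finite_subset[of _ "{..<n} \<times> {..<n}"]) auto
  define w where "w P a b = (\<lambda>(k,l). if P k l then \<phi> (max (a k l) (b k l)) else 0)"
    for P and a b :: "nat \<Rightarrow> nat \<Rightarrow> nat"
  have w: "(\<Sum>t\<in>?T. w P a b t) \<le> 2 * Phi1 \<phi>"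
    if inj: "\<And>k l k' l'. (k,l) \<in> ?T \<Longrightarrow> P k l \<Longrightarrow> (k',l') \<in> ?T \<Longrightarrow> P k' l' \<Longrightarrow>
        a k l = a k' l' \<Longrightarrow> b k l = b k' l' \<Longrightarrow> k = k' \<and> l = l'"
      and pos: "\<And>k l. (k,l) \<in> ?T \<Longrightarrow> P k l \<Longrightarrow> 1 \<le> a k l \<and> 1 \<le> b k l" for P a b
  proof -
    have "(\<Sum>t\<in>?T. w P a b t) = (\<Sum>t\<in>{(k,l)\<in>?T. P k l}. w P a b t)"
      by (rule sum.mono_neutral_right[OF fin]) (auto simp: w_def split: if_splits)
    also have "\<dots> = (\<Sum>t\<in>{(k,l)\<in>?T. P k l}. \<phi> (max (fst (case t of (k,l) \<Rightarrow> (a k l, b k l)))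
                      (snd (case t of (k,l) \<Rightarrow> (a k l, b k l)))))"
      by (intro sum.cong) (auto simp: w_def split: if_splits)
    also have "\<dots> \<le> 2 * Phi1 \<phi>"
    proof (rule sum_phi_max_le)
      show "finite {(k,l)\<in>?T. P k l}" by (rule finite_subset[OF _ fin]) auto
      show "inj_on (\<lambda>(k,l). (a k l, b k l)) {(k,l)\<in>?T. P k l}"
      proof (rule inj_onI)
        fix s t assume st: "s \<in> {(k,l)\<in>?T. P k l}" "t \<in> {(k,l)\<in>?T. P k l}"
          and eq: "(case s of (k,l) \<Rightarrow> (a k l, b k l)) = (case t of (k,l) \<Rightarrow> (a k l, b k l))"
        obtain k l k' l' where p: "s = (k,l)" "t = (k',l')" by fastforce
        have "k = k' \<and> l = l'" by (rule inj) (use st eq p in auto)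
        then show "s = t" using p by simp
      qed
    qed (use pos in auto)
    finally show ?thesis .
  qed
  \<comment> \<open>One weight for each relative order; the two gaps are those provided by
    \<open>abs_pair_cov_separated\<close> or \<open>abs_pair_cov_crossing\<close> for the sorted quadruple.\<close>
  define w1 where "w1 = w (\<lambda>k l. j < k) (\<lambda>k l. k - j) (\<lambda>k l. l - k)"
  define w2 where "w2 = w (\<lambda>k l. i < k \<and> k < j \<and> j < l) (\<lambda>k l. k - i) (\<lambda>k l. l - j)"
  define w3 where "w3 = w (\<lambda>k l. i < k \<and> l < j) (\<lambda>k l. k - i) (\<lambda>k l. j - l)"
  define w4 where "w4 = w (\<lambda>k l. k < i \<and> j < l) (\<lambda>k l. i - k) (\<lambda>k l. l - j)"
  define w5 where "w5 = w (\<lambda>k l. k < i \<and> i < l \<and> l < j) (\<lambda>k l. i - k) (\<lambda>k l. j - l)"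
  define w6 where "w6 = w (\<lambda>k l. l < i) (\<lambda>k l. l - k) (\<lambda>k l. i - l)"
  have A1: "u - c = v - c \<Longrightarrow> c < u \<Longrightarrow> c < v \<Longrightarrow> u = v" for u v c :: nat by simp
  have A2: "c - u = c - v \<Longrightarrow> u < c \<Longrightarrow> v < c \<Longrightarrow> u = v" for u v c :: nat by simp
  have le1: "(\<Sum>t\<in>?T. w1 t) \<le> 2 * Phi1 \<phi>"
    unfolding w1_def by (rule w) (auto dest: A1 A2)
  have le2: "(\<Sum>t\<in>?T. w2 t) \<le> 2 * Phi1 \<phi>"
    unfolding w2_def by (rule w) (auto dest: A1 A2)
  have le3: "(\<Sum>t\<in>?T. w3 t) \<le> 2 * Phi1 \<phi>"
    unfolding w3_def by (rule w) (auto dest: A1 A2)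
  have le4: "(\<Sum>t\<in>?T. w4 t) \<le> 2 * Phi1 \<phi>"
    unfolding w4_def by (rule w) (auto dest: A1 A2)
  have le5: "(\<Sum>t\<in>?T. w5 t) \<le> 2 * Phi1 \<phi>"
    unfolding w5_def by (rule w) (auto dest: A1 A2)
  have le6: "(\<Sum>t\<in>?T. w6 t) \<le> 2 * Phi1 \<phi>"
    unfolding w6_def by (rule w) (auto dest: A1 A2)
  have wnn: "0 \<le> w P a b (k,l)" if "P k l \<Longrightarrow> 1 \<le> a k l" for P a b k l
  proof (cases "P k l")
    case True
    then have "1 \<le> max (a k l) (b k l)" using that by simp
    then show ?thesis using True by (simp add: w_def phi_nonneg)
  qed (simp add: w_def)
  have pt: "\<bar>pair_cov i j k l\<bar> \<le> 2 * (w1 (k,l) + w2 (k,l) + w3 (k,l) + w4 (k,l) + w5 (k,l) + w6 (k,l))"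
    if "(k,l) \<in> ?T" for k l
  proof -
    have kl: "k < l" "k \<noteq> i" "k \<noteq> j" "l \<noteq> i" "l \<noteq> j" using that by auto
    then consider "j < k" | "i < k" "k < j" "j < l" | "i < k" "l < j" | "k < i" "j < l"
      | "k < i" "i < l" "l < j" | "l < i" by linarith
    then have "\<bar>pair_cov i j k l\<bar> \<le> 2 * w1 (k,l) \<or> \<bar>pair_cov i j k l\<bar> \<le> 2 * w2 (k,l)
      \<or> \<bar>pair_cov i j k l\<bar> \<le> 2 * w3 (k,l) \<or> \<bar>pair_cov i j k l\<bar> \<le> 2 * w4 (k,l)
      \<or> \<bar>pair_cov i j k l\<bar> \<le> 2 * w5 (k,l) \<or> \<bar>pair_cov i j k l\<bar> \<le> 2 * w6 (k,l)"
    proof cases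
      case 1 then show ?thesis using abs_pair_cov_separated(1)[of i j k l] kl assms
        by (simp add: w1_def w_def)
    next
      case 2 then show ?thesis using abs_pair_cov_crossing(1)[of i k j l] kl assms
        by (simp add: w2_def w_def)
    next
      case 3 then show ?thesis using abs_pair_cov_crossing(2)[of i k l j] kl assms
        by (simp add: w3_def w_def)
    next
      case 4 then show ?thesis using abs_pair_cov_crossing(2)[of k i j l] kl assms
        by (simp add: w4_def w_def pair_cov_swap(3)[of i j])
    next
      case 5 then show ?thesis using abs_pair_cov_crossing(1)[of k i l j] kl assms
        by (simp add: w5_def w_def pair_cov_swap(3)[of i j])
    next
      case 6 then show ?thesis using abs_pair_cov_separated(2)[of k l i j] kl assms
        by (simp add: w6_def w_def pair_cov_swap(3)[of i j])
    qed
    moreover have "0 \<le> w1 (k,l)" "0 \<le> w2 (k,l)" "0 \<le> w3 (k,l)"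
      "0 \<le> w4 (k,l)" "0 \<le> w5 (k,l)" "0 \<le> w6 (k,l)"
      unfolding w1_def w2_def w3_def w4_def w5_def w6_def
      by (rule wnn, use kl in arith)+
    ultimately show ?thesis unfolding distrib_left by linarith
  qed
  have "(\<Sum>(k,l)\<in>?T. \<bar>pair_cov i j k l\<bar>)
     \<le> (\<Sum>t\<in>?T. 2 * (w1 t + w2 t + w3 t + w4 t + w5 t + w6 t))"
    using pt by (intro sum_mono) auto
  also have "\<dots> \<le> 24 * Phi1 \<phi>"
    unfolding sum_distrib_left[symmetric] sum.distrib using le1 le2 le3 le4 le5 le6 by simp
  finally show ?thesis .
qed

lemma sum_abs_pair_cov:
  assumes "i \<noteq> j"
  shows "(\<Sum>k<n. \<Sum>l<n. if k \<noteq> l \<and> k \<notin> {i,j} \<and> l \<notin> {i,j} then \<bar>pair_cov i j k l\<bar> else 0) \<le> 48 * Phi1 \<phi>"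
proof -
  define i' j' where "i' = min i j" and "j' = max i j"
  have ij: "i' < j'" "{i',j'} = {i,j}" using assms by (auto simp: i'_def j'_def min_def max_def)
  have K: "pair_cov i j k l = pair_cov i' j' k l" for k l
    by (auto simp: i'_def j'_def min_def max_def pair_cov_swap(1)[of i j])
  let ?T = "{(k,l). k < l \<and> l < n \<and> k \<notin> {i',j'} \<and> l \<notin> {i',j'}}"
  let ?T' = "{(k,l). l < k \<and> k < n \<and> k \<notin> {i',j'} \<and> l \<notin> {i',j'}}"
  have fin: "finite ?T" "finite ?T'"
    by (rule finite_subset[of _ "{..<n} \<times> {..<n}"], auto)+
  have "(\<Sum>k<n. \<Sum>l<n. if k \<noteq> l \<and> k \<notin> {i,j} \<and> l \<notin> {i,j} then \<bar>pair_cov i j k l\<bar> else 0)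
    = (\<Sum>t\<in>{..<n}\<times>{..<n}. case t of (k,l) \<Rightarrow> if k \<noteq> l \<and> k \<notin> {i',j'} \<and> l \<notin> {i',j'} then \<bar>pair_cov i' j' k l\<bar> else 0)"
    unfolding ij(2) K by (simp add: sum.cartesian_product)
  also have "\<dots> = (\<Sum>(k,l)\<in>?T \<union> ?T'. \<bar>pair_cov i' j' k l\<bar>)"
  proof (rule sum.mono_neutral_cong_right)
    show "\<forall>t\<in>{..<n} \<times> {..<n} - (?T \<union> ?T'). (case t of (k, l) \<Rightarrow>
        if k \<noteq> l \<and> k \<notin> {i', j'} \<and> l \<notin> {i', j'} then \<bar>pair_cov i' j' k l\<bar> else 0) = 0"
    proof
      fix t assume t: "t \<in> {..<n} \<times> {..<n} - (?T \<union> ?T')"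
      obtain k l where "t = (k,l)" by fastforce
      with t show "(case t of (k, l) \<Rightarrow>
          if k \<noteq> l \<and> k \<notin> {i', j'} \<and> l \<notin> {i', j'} then \<bar>pair_cov i' j' k l\<bar> else 0) = 0"
        by (cases k l rule: linorder_cases) auto
    qed
  qed auto
  also have "\<dots> = (\<Sum>(k,l)\<in>?T. \<bar>pair_cov i' j' k l\<bar>) + (\<Sum>(k,l)\<in>?T'. \<bar>pair_cov i' j' k l\<bar>)"
  proof (rule sum.union_disjoint[OF fin])
    show "?T \<inter> ?T' = {}" by fastforce
  qed
  also have "(\<Sum>(k,l)\<in>?T'. \<bar>pair_cov i' j' k l\<bar>) = (\<Sum>(k,l)\<in>?T. \<bar>pair_cov i' j' k l\<bar>)"
    by (rule sum.reindex_bij_witness[of _ prod.swap prod.swap])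
      (auto simp: pair_cov_swap(2)[of i' j'])
  finally show ?thesis using sum_abs_pair_cov_ordered[OF ij(1), of n] by simp
qed

lemma pow4_le_Phi0: "expectation (\<lambda>\<omega>. Y i \<omega> ^ 4) \<le> Phi0 M X"
  unfolding Phi0_def by (rule cSUP_upper[OF _ Phi0_finite]) simp

lemma Phi0_nonneg: "0 \<le> Phi0 M X"
proof -
  have "0 \<le> expectation (\<lambda>\<omega>. Y 0 \<omega> ^ 4)" by simp
  then show ?thesis using pow4_le_Phi0[of 0] by linarith
qed

lemma m4_squares_le_Phi0: "m4 i i j j \<le> Phi0 M X"
proof -
  have "m4 i i j j \<le> expectation (\<lambda>\<omega>. (Y i \<omega> ^ 4 + Y j \<omega> ^ 4) / 2)"
    unfolding m4_def
  proof (rule integral_mono)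
    fix \<omega>
    have "0 \<le> ((Y i \<omega>)^2 - (Y j \<omega>)^2)^2" by simp
    then show "Y i \<omega> * Y i \<omega> * (Y j \<omega> * Y j \<omega>) \<le> (Y i \<omega> ^ 4 + Y j \<omega> ^ 4) / 2"
      by (simp add: power2_eq_square power4_eq_xxxx algebra_simps)
  qed (auto intro!: integrable_prod4 integrable_pow4)
  also have "\<dots> \<le> Phi0 M X"
    using pow4_le_Phi0[of i] pow4_le_Phi0[of j] by (simp add: integrable_pow4)
  finally show ?thesis .
qed

section \<open>Fourth moments of linear forms\<close>

text \<open>
  In a sorted quadruple \<open>i < j < k < l\<close>, the outer gaps together with either \<open>j, l\<close> or \<open>i, k\<close>
  determine the remaining two indices.
\<close>

lemma sum_phi_two_gaps:
  "(\<Sum>k<n. \<Sum>i<n. if i < j \<and> k < l then \<phi> (max (j - i) (l - k)) else 0) \<le> 2 * Phi1 \<phi>"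
  "(\<Sum>l<n. \<Sum>j<n. if i < j \<and> k < l then \<phi> (max (j - i) (l - k)) else 0) \<le> 2 * Phi1 \<phi>"
proof -
  have "(\<Sum>k<n. \<Sum>i<n. if i < j \<and> k < l then \<phi> (max (j - i) (l - k)) else 0)
    = (\<Sum>t\<in>{..<n}\<times>{..<n}. if snd t < j \<and> fst t < l then \<phi> (max (j - snd t) (l - fst t)) else 0)"
    by (simp add: sum.cartesian_product case_prod_beta)
  also have "\<dots> = (\<Sum>t\<in>{t\<in>{..<n}\<times>{..<n}. snd t < j \<and> fst t < l}.
      \<phi> (max (fst (j - snd t, l - fst t)) (snd (j - snd t, l - fst t))))"
    by (simp add: sum.inter_filter)
  also have "\<dots> \<le> 2 * Phi1 \<phi>"
    by (rule sum_phi_max_le) (auto simp: inj_on_def)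
  finally show "(\<Sum>k<n. \<Sum>i<n. if i < j \<and> k < l then \<phi> (max (j - i) (l - k)) else 0) \<le> 2 * Phi1 \<phi>" .
  have "(\<Sum>l<n. \<Sum>j<n. if i < j \<and> k < l then \<phi> (max (j - i) (l - k)) else 0)
    = (\<Sum>t\<in>{..<n}\<times>{..<n}. if i < snd t \<and> k < fst t then \<phi> (max (snd t - i) (fst t - k)) else 0)"
    by (simp add: sum.cartesian_product case_prod_beta)
  also have "\<dots> = (\<Sum>t\<in>{t\<in>{..<n}\<times>{..<n}. i < snd t \<and> k < fst t}.
      \<phi> (max (fst (snd t - i, fst t - k)) (snd (snd t - i, fst t - k))))"
    by (simp add: sum.inter_filter)
  also have "\<dots> \<le> 2 * Phi1 \<phi>"
    by (rule sum_phi_max_le) (auto simp: inj_on_def)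
  finally show "(\<Sum>l<n. \<Sum>j<n. if i < j \<and> k < l then \<phi> (max (j - i) (l - k)) else 0) \<le> 2 * Phi1 \<phi>" .
qed

text \<open>
  The moment is controlled by the two outer gaps only, so the coefficients have to be paired as
  \<open>(b i * b k) * (b j * b l)\<close>: fixing \<open>i, k\<close> or \<open>j, l\<close> leaves exactly these gaps free, whereas fixing
  \<open>i, j\<close> would leave the middle gap, over which nothing decays.
\<close>

lemma ordered_m4_sum_le:
  "(\<Sum>l<n. \<Sum>k<l. \<Sum>j<k. \<Sum>i<j. b i * b j * (b k * b l) * m4 i j k l)
     \<le> 2 * Phi1 \<phi> * (\<Sum>i<n. (b i)^2)^2"
proof -
  define W where "W i j k l = (if i < j \<and> k < l then \<phi> (max (j - i) (l - k)) else 0)" for i j k l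
  have Wnn: "0 \<le> W i j k l" for i j k l
  proof (cases "i < j \<and> k < l")
    case True
    then have "1 \<le> max (j - i) (l - k)" by auto
    then show ?thesis using True by (simp add: W_def phi_nonneg)
  qed (auto simp: W_def)
  have sq: "(\<Sum>i<n. (b i)^2)^2 = (\<Sum>l<n. \<Sum>j<n. (b j * b l)^2)"
    by (simp add: power2_eq_square sum_distrib_left sum_distrib_right ac_simps)
  have "(\<Sum>l<n. \<Sum>k<l. \<Sum>j<k. \<Sum>i<j. b i * b j * (b k * b l) * m4 i j k l)
     \<le> (\<Sum>l<n. \<Sum>j<n. \<Sum>k<n. \<Sum>i<n. ((b i * b k)^2 + (b j * b l)^2) / 2 * W i j k l)"
  proof (rule ordered_sum_le)
    fix i j k l :: nat assume o: "i < j" "j < k" "k < l" "l < n"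
    have m: "\<bar>m4 i j k l\<bar> \<le> W i j k l"
      using abs_m4_le_phi[OF o(1-3)] o by (auto simp: W_def max_def)
    have "0 \<le> (\<bar>b i * b k\<bar> - \<bar>b j * b l\<bar>)^2" by simp
    then have c: "\<bar>b i * b k\<bar> * \<bar>b j * b l\<bar> \<le> ((b i * b k)^2 + (b j * b l)^2) / 2"
      unfolding power2_diff by simp
    have "b i * b j * (b k * b l) * m4 i j k l \<le> \<bar>b i * b k\<bar> * \<bar>b j * b l\<bar> * \<bar>m4 i j k l\<bar>"
      using abs_ge_self[of "b i * b j * (b k * b l) * m4 i j k l"] by (simp add: abs_mult ac_simps)
    also have "\<dots> \<le> ((b i * b k)^2 + (b j * b l)^2) / 2 * W i j k l"
      by (intro mult_mono c m) auto
    finally show "b i * b j * (b k * b l) * m4 i j k l \<le> ((b i * b k)^2 + (b j * b l)^2) / 2 * W i j k l" .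
  qed (auto intro!: mult_nonneg_nonneg Wnn)
  also have "\<dots> = ((\<Sum>l<n. \<Sum>j<n. \<Sum>k<n. \<Sum>i<n. (b i * b k)^2 * W i j k l)
        + (\<Sum>l<n. \<Sum>j<n. \<Sum>k<n. \<Sum>i<n. (b j * b l)^2 * W i j k l)) / 2"
    by (simp add: sum.distrib[symmetric] sum_divide_distrib distrib_right add_divide_distrib)
  also have "(\<Sum>l<n. \<Sum>j<n. \<Sum>k<n. \<Sum>i<n. (b j * b l)^2 * W i j k l)
     = (\<Sum>l<n. \<Sum>j<n. (b j * b l)^2 * (\<Sum>k<n. \<Sum>i<n. W i j k l))"
    by (simp add: sum_distrib_left)
  also have "\<dots> \<le> (\<Sum>l<n. \<Sum>j<n. (b j * b l)^2 * (2 * Phi1 \<phi>))"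
    unfolding W_def by (intro sum_mono mult_left_mono sum_phi_two_gaps) auto
  also have "(\<Sum>l<n. \<Sum>j<n. \<Sum>k<n. \<Sum>i<n. (b i * b k)^2 * W i j k l)
     = (\<Sum>l<n. \<Sum>k<n. \<Sum>j<n. \<Sum>i<n. (b i * b k)^2 * W i j k l)"
    by (rule sum.cong[OF refl], rule sum.swap)
  also have "\<dots> = (\<Sum>k<n. \<Sum>l<n. \<Sum>i<n. \<Sum>j<n. (b i * b k)^2 * W i j k l)"
    by (subst sum.swap) (rule sum.cong[OF refl], rule sum.cong[OF refl], rule sum.swap)
  also have "\<dots> = (\<Sum>k<n. \<Sum>i<n. (b i * b k)^2 * (\<Sum>l<n. \<Sum>j<n. W i j k l))"
    unfolding sum_distrib_left by (rule sum.cong[OF refl], rule sum.swap)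
  also have "\<dots> \<le> (\<Sum>k<n. \<Sum>i<n. (b i * b k)^2 * (2 * Phi1 \<phi>))"
    unfolding W_def by (intro sum_mono mult_left_mono sum_phi_two_gaps) auto
  finally show ?thesis
    unfolding sum_distrib_right[symmetric] sq[symmetric] by (simp add: field_simps)
qed

lemma linear_form_fourth_moment:
  "integrable M (\<lambda>\<omega>. (\<Sum>k<n. b k * Y k \<omega>)^4)" (is ?int)
  "expectation (\<lambda>\<omega>. (\<Sum>k<n. b k * Y k \<omega>)^4)
     \<le> (114 * Phi0 M X + 96 * Phi1 \<phi>) * (\<Sum>k<n. (b k)^2)^2" (is ?bound)
proof -
  have "(\<Sum>k<n. b k * Y k \<omega>)^4 = (\<Sum>i<n. \<Sum>j<n. \<Sum>k<n. \<Sum>l<n.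
      b i * b j * (b k * b l) * (Y i \<omega> * Y j \<omega> * (Y k \<omega> * Y l \<omega>)))" for \<omega>
    unfolding power4_eq_xxxx
    by (simp add: sum_distrib_left sum_distrib_right ac_simps)
  then show int: ?int
    by (simp only:) (intro Bochner_Integration.integrable_sum integrable_mult_right integrable_prod4)
  have e4: "esym 4 (\<lambda>k. b k * Y k \<omega>) n = (\<Sum>l<n. \<Sum>k<l. \<Sum>j<k. \<Sum>i<j.
      b i * b j * (b k * b l) * (Y i \<omega> * Y j \<omega> * (Y k \<omega> * Y l \<omega>)))" for \<omega>
    by (simp add: numeral_eq_Suc sum_distrib_left sum_distrib_right ac_simps)
  have p2: "(\<Sum>k<n. (b k * Y k \<omega>)^2)^2 = (\<Sum>i<n. \<Sum>j<n.
      (b i)^2 * (b j)^2 * (Y i \<omega> * Y i \<omega> * (Y j \<omega> * Y j \<omega>)))" for \<omega>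
    by (simp add: power2_eq_square sum_distrib_left sum_distrib_right ac_simps)
  have "expectation (\<lambda>\<omega>. (\<Sum>k<n. b k * Y k \<omega>)^4) \<le> expectation (\<lambda>\<omega>.
     48 * esym 4 (\<lambda>k. b k * Y k \<omega>) n + 114 * (\<Sum>k<n. (b k * Y k \<omega>)^2)^2)"
  proof (rule integral_mono[OF int])
    show "integrable M (\<lambda>\<omega>. 48 * esym 4 (\<lambda>k. b k * Y k \<omega>) n + 114 * (\<Sum>k<n. (b k * Y k \<omega>)^2)^2)"
      unfolding e4 p2
      by (intro Bochner_Integration.integrable_add integrable_mult_right
          Bochner_Integration.integrable_sum integrable_prod4)
  qed (rule sum_pow4_le_esym4)
  also have "\<dots> = 48 * (\<Sum>l<n. \<Sum>k<l. \<Sum>j<k. \<Sum>i<j. b i * b j * (b k * b l) * m4 i j k l)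
      + 114 * (\<Sum>i<n. \<Sum>j<n. (b i)^2 * (b j)^2 * m4 i i j j)"
    unfolding e4 p2 m4_def by (simp add: integrable_prod4)
  also have "\<dots> \<le> 48 * (2 * Phi1 \<phi> * (\<Sum>i<n. (b i)^2)^2)
      + 114 * (\<Sum>i<n. \<Sum>j<n. (b i)^2 * (b j)^2 * Phi0 M X)"
    by (intro add_mono mult_left_mono ordered_m4_sum_le sum_mono m4_squares_le_Phi0) auto
  also have "\<dots> = (114 * Phi0 M X + 96 * Phi1 \<phi>) * (\<Sum>k<n. (b k)^2)^2"
    by (simp add: power2_eq_square sum_distrib_left sum_distrib_right algebra_simps)
  finally show ?bound .
qed

section \<open>Variances of quadratic forms\<close>

definition quad :: "(nat \<Rightarrow> nat \<Rightarrow> real) \<Rightarrow> nat \<Rightarrow> 'a \<Rightarrow> real" where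
  "quad b n \<omega> = (\<Sum>i<n. \<Sum>j<n. b i j * (Y i \<omega> * Y j \<omega>))"

lemma quad_mult_quad: "quad b n \<omega> * quad c n \<omega> =
  (\<Sum>i<n. \<Sum>j<n. \<Sum>k<n. \<Sum>l<n. b i j * c k l * (Y i \<omega> * Y j \<omega> * (Y k \<omega> * Y l \<omega>)))"
  unfolding quad_def sum_distrib_right unfolding sum_distrib_left by (simp only: ac_simps)

lemma integrable_quad: "integrable M (quad b n)"
  unfolding quad_def[abs_def]
  by (intro Bochner_Integration.integrable_sum integrable_mult_right integrable_prod2)

lemma integrable_quad_sq: "integrable M (\<lambda>\<omega>. (quad b n \<omega>)^2)"
  unfolding power2_eq_square quad_mult_quad
  by (intro Bochner_Integration.integrable_sum integrable_mult_right integrable_prod4)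

lemma variance_quad:
  "variance (quad b n) = (\<Sum>i<n. \<Sum>j<n. \<Sum>k<n. \<Sum>l<n. b i j * b k l * pair_cov i j k l)"
proof -
  have "expectation (\<lambda>\<omega>. (quad b n \<omega>)^2) = (\<Sum>i<n. \<Sum>j<n. \<Sum>k<n. \<Sum>l<n. b i j * b k l * m4 i j k l)"
    unfolding power2_eq_square quad_mult_quad m4_def by (simp add: integrable_prod4)
  moreover have "expectation (quad b n) = (\<Sum>i<n. \<Sum>j<n. b i j * m2 i j)"
    unfolding quad_def[abs_def] m2_def by (simp add: integrable_prod2)
  then have "(expectation (quad b n))^2
      = (\<Sum>i<n. \<Sum>j<n. \<Sum>k<n. \<Sum>l<n. b i j * b k l * (m2 i j * m2 k l))"
    unfolding power2_eq_square
    by (simp only: sum_distrib_right) (simp only: sum_distrib_left ac_simps)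
  ultimately show ?thesis
    by (simp add: variance_eq[OF integrable_quad integrable_quad_sq] pair_cov_def
       sum_subtractf[symmetric] right_diff_distrib)
qed

lemma variance_quad_add:
  "variance (\<lambda>\<omega>. quad b n \<omega> + quad c n \<omega>) \<le> 2 * variance (quad b n) + 2 * variance (quad c n)"
proof -
  let ?e = "expectation (quad b n)" and ?f = "expectation (quad c n)"
  have i: "integrable M (\<lambda>\<omega>. (quad d n \<omega> - r)^2)" for d r
    unfolding power2_diff
    by (intro Bochner_Integration.integrable_add Bochner_Integration.integrable_diff integrable_quad_sq
       integrable_mult_left integrable_mult_right integrable_quad) auto
  have "variance (\<lambda>\<omega>. quad b n \<omega> + quad c n \<omega>)
      = expectation (\<lambda>\<omega>. ((quad b n \<omega> - ?e) + (quad c n \<omega> - ?f))^2)"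
    using integrable_quad by (simp add: algebra_simps)
  also have "\<dots> \<le> expectation (\<lambda>\<omega>. 2 * (quad b n \<omega> - ?e)^2 + 2 * (quad c n \<omega> - ?f)^2)"
  proof (rule integral_mono')
    fix \<omega>
    have "0 \<le> ((quad b n \<omega> - ?e) - (quad c n \<omega> - ?f))^2" by simp
    then show "((quad b n \<omega> - ?e) + (quad c n \<omega> - ?f))^2 \<le> 2 * (quad b n \<omega> - ?e)^2 + 2 * (quad c n \<omega> - ?f)^2"
      by (simp add: power2_eq_square algebra_simps)
  qed (auto intro!: i)
  also have "\<dots> = 2 * variance (quad b n) + 2 * variance (quad c n)"
    using i by simp
  finally show ?thesis .
qed

lemma pair_cov_self_nonneg: "0 \<le> pair_cov i j i j"
proof -
  have "integrable M (\<lambda>\<omega>. (Y i \<omega> * Y j \<omega>)^2)"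
    unfolding power2_eq_square by (rule integrable_prod4)
  then have "variance (\<lambda>\<omega>. Y i \<omega> * Y j \<omega>) = pair_cov i j i j"
    using variance_eq[OF integrable_prod2[of i j]]
    by (simp add: pair_cov_def m4_def m2_def power2_eq_square)
  then show ?thesis by (metis variance_positive)
qed

lemma sum_disjoint_pairs_le:
  assumes diag: "\<And>i. b i i = 0"
  shows "(\<Sum>i<n. \<Sum>j<n. \<Sum>k<n. \<Sum>l<n.
         if k \<notin> {i,j} \<and> l \<notin> {i,j} then b i j * b k l * pair_cov i j k l else 0)
     \<le> 48 * Phi1 \<phi> * (\<Sum>i<n. \<Sum>j<n. (b i j)^2)"
proof -
  \<comment> \<open>Symmetric under exchange of the two pairs, so that both halves of the arithmetic-geometric mean
    inequality lead to the same sum.\<close>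
  define V where "V i j k l = (if i \<noteq> j \<and> k \<noteq> l \<and> k \<notin> {i,j} \<and> l \<notin> {i,j} then \<bar>pair_cov i j k l\<bar> else 0)"
    for i j k l
  have Vsym: "V i j k l = V k l i j" for i j k l
    by (auto simp: V_def pair_cov_swap(3)[of i j])
  have Vsum: "(\<Sum>k<n. \<Sum>l<n. V i j k l) \<le> 48 * Phi1 \<phi>" for i j
    using sum_abs_pair_cov[of i j n] Phi1_nonneg by (cases "i = j") (simp_all add: V_def)
  have "(\<Sum>i<n. \<Sum>j<n. \<Sum>k<n. \<Sum>l<n.
         if k \<notin> {i,j} \<and> l \<notin> {i,j} then b i j * b k l * pair_cov i j k l else 0)
     \<le> (\<Sum>i<n. \<Sum>j<n. \<Sum>k<n. \<Sum>l<n. ((b i j)^2 * V i j k l + (b k l)^2 * V i j k l) / 2)"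
  proof (intro sum_mono)
    fix i j k l
    show "(if k \<notin> {i,j} \<and> l \<notin> {i,j} then b i j * b k l * pair_cov i j k l else 0)
      \<le> ((b i j)^2 * V i j k l + (b k l)^2 * V i j k l) / 2"
    proof (cases "i \<noteq> j \<and> k \<noteq> l \<and> k \<notin> {i,j} \<and> l \<notin> {i,j}")
      case True
      have "0 \<le> (\<bar>b i j\<bar> - \<bar>b k l\<bar>)^2" by simp
      then have "\<bar>b i j\<bar> * \<bar>b k l\<bar> \<le> ((b i j)^2 + (b k l)^2) / 2"
        unfolding power2_diff by simp
      then have "\<bar>b i j\<bar> * \<bar>b k l\<bar> * \<bar>pair_cov i j k l\<bar> \<le> ((b i j)^2 + (b k l)^2) / 2 * \<bar>pair_cov i j k l\<bar>"
        by (rule mult_right_mono) simp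
      moreover have "b i j * b k l * pair_cov i j k l \<le> \<bar>b i j\<bar> * \<bar>b k l\<bar> * \<bar>pair_cov i j k l\<bar>"
        using abs_ge_self[of "b i j * b k l * pair_cov i j k l"] by (simp add: abs_mult)
      ultimately show ?thesis using True by (simp add: V_def algebra_simps)
    next
      case False
      then have "b i j * b k l = 0 \<or> \<not> (k \<notin> {i,j} \<and> l \<notin> {i,j})" using diag by auto
      then show ?thesis by (auto simp: V_def)
    qed
  qed
  also have "\<dots> = ((\<Sum>i<n. \<Sum>j<n. \<Sum>k<n. \<Sum>l<n. (b i j)^2 * V i j k l)
      + (\<Sum>i<n. \<Sum>j<n. \<Sum>k<n. \<Sum>l<n. (b k l)^2 * V i j k l)) / 2"
    by (simp add: sum.distrib sum_divide_distrib add_divide_distrib)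
  also have "(\<Sum>i<n. \<Sum>j<n. \<Sum>k<n. \<Sum>l<n. (b k l)^2 * V i j k l)
      = (\<Sum>i<n. \<Sum>j<n. \<Sum>k<n. \<Sum>l<n. (b i j)^2 * V i j k l)"
    by (subst sum_swap_pairs) (intro sum.cong refl arg_cong2[where f = "(*)"] Vsym)
  also have "(\<Sum>i<n. \<Sum>j<n. \<Sum>k<n. \<Sum>l<n. (b i j)^2 * V i j k l)
      = (\<Sum>i<n. \<Sum>j<n. (b i j)^2 * (\<Sum>k<n. \<Sum>l<n. V i j k l))"
    by (simp add: sum_distrib_left)
  finally have "(\<Sum>i<n. \<Sum>j<n. \<Sum>k<n. \<Sum>l<n.
         if k \<notin> {i,j} \<and> l \<notin> {i,j} then b i j * b k l * pair_cov i j k l else 0)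
    \<le> (\<Sum>i<n. \<Sum>j<n. (b i j)^2 * (\<Sum>k<n. \<Sum>l<n. V i j k l))" by simp
  also have "\<dots> \<le> (\<Sum>i<n. \<Sum>j<n. (b i j)^2 * (48 * Phi1 \<phi>))"
    by (intro sum_mono mult_left_mono Vsum) simp
  finally show ?thesis
    unfolding sum_distrib_right[symmetric] by (simp add: mult.commute)
qed

text \<open>
  The left-hand side is the variance of \<open>Y i * S\<close> with the linear form \<open>S = (\<Sum>j<n. b j * Y j)\<close>, hence at
  most the expectation of \<open>(Y i)\<^sup>2 * S\<^sup>2\<close>. The latter is split into fourth moments by the weighted
  inequality of the two means; the weight \<open>\<beta> = (\<Sum>j<n. (b j)\<^sup>2)\<close> makes both parts of order \<open>\<beta>\<close>.
\<close>

lemma sum_shared_index_le: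
  "(\<Sum>j<n. \<Sum>l<n. b j * b l * pair_cov i j i l)
     \<le> (115 * Phi0 M X + 96 * Phi1 \<phi>) / 2 * (\<Sum>j<n. (b j)^2)"
proof (cases "(\<Sum>j<n. (b j)^2) = 0")
  case True
  then have "b j = 0" if "j < n" for j
    using that by (subst (asm) sum_nonneg_eq_0_iff) auto
  with True show ?thesis by simp
next
  case False
  define \<beta> where "\<beta> = (\<Sum>j<n. (b j)^2)"
  have \<beta>: "0 < \<beta>" using False unfolding \<beta>_def by (simp add: sum_nonneg order_less_le)
  define S where "S \<omega> = (\<Sum>j<n. b j * Y j \<omega>)" for \<omega>
  have S4: "integrable M (\<lambda>\<omega>. S \<omega> ^ 4)"
    "expectation (\<lambda>\<omega>. S \<omega> ^ 4) \<le> (114 * Phi0 M X + 96 * Phi1 \<phi>) * \<beta>^2"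
    unfolding S_def \<beta>_def by (rule linear_form_fourth_moment)+
  have ex: "(Y i \<omega>)^2 * (S \<omega>)^2 = (\<Sum>j<n. \<Sum>l<n. b j * b l * (Y i \<omega> * Y j \<omega> * (Y i \<omega> * Y l \<omega>)))" for \<omega>
    by (simp add: S_def power2_eq_square sum_distrib_left sum_distrib_right ac_simps)
  have "(\<Sum>j<n. \<Sum>l<n. b j * b l * pair_cov i j i l)
     = (\<Sum>j<n. \<Sum>l<n. b j * b l * m4 i j i l) - (\<Sum>j<n. b j * m2 i j)^2"
    by (simp add: pair_cov_def right_diff_distrib sum_subtractf power2_eq_square
        sum_distrib_left sum_distrib_right ac_simps)
  also have "\<dots> \<le> (\<Sum>j<n. \<Sum>l<n. b j * b l * m4 i j i l)" by simp
  also have "\<dots> = expectation (\<lambda>\<omega>. (Y i \<omega>)^2 * (S \<omega>)^2)"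
    unfolding ex m4_def by (simp add: integrable_prod4)
  also have "\<dots> \<le> expectation (\<lambda>\<omega>. (\<beta> * Y i \<omega> ^ 4 + S \<omega> ^ 4 / \<beta>) / 2)"
  proof (rule integral_mono)
    show "integrable M (\<lambda>\<omega>. (Y i \<omega>)^2 * (S \<omega>)^2)"
      unfolding ex by (intro Bochner_Integration.integrable_sum integrable_mult_right integrable_prod4)
    show "integrable M (\<lambda>\<omega>. (\<beta> * Y i \<omega> ^ 4 + S \<omega> ^ 4 / \<beta>) / 2)"
      using S4(1) integrable_pow4 by simp
    fix \<omega>
    have "0 \<le> (\<beta> * (Y i \<omega>)^2 - (S \<omega>)^2)^2 / \<beta>" using \<beta> by simp
    also have "\<dots> = \<beta> * Y i \<omega> ^ 4 + S \<omega> ^ 4 / \<beta> - 2 * ((Y i \<omega>)^2 * (S \<omega>)^2)"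
      using \<beta> by (simp add: field_simps power2_eq_square power4_eq_xxxx)
    finally show "(Y i \<omega>)^2 * (S \<omega>)^2 \<le> (\<beta> * Y i \<omega> ^ 4 + S \<omega> ^ 4 / \<beta>) / 2" by simp
  qed
  also have "\<dots> = (\<beta> * expectation (\<lambda>\<omega>. Y i \<omega> ^ 4) + expectation (\<lambda>\<omega>. S \<omega> ^ 4) / \<beta>) / 2"
    using S4(1) integrable_pow4 by simp
  also have "\<dots> \<le> (\<beta> * Phi0 M X + (114 * Phi0 M X + 96 * Phi1 \<phi>) * \<beta>^2 / \<beta>) / 2"
    using \<beta> by (intro divide_right_mono add_mono mult_left_mono pow4_le_Phi0 S4(2)) auto
  also have "\<dots> = (115 * Phi0 M X + 96 * Phi1 \<phi>) / 2 * \<beta>"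
  proof -
    have cancel: "r * \<beta>^2 / \<beta> = r * \<beta>" for r using \<beta> by (simp add: power2_eq_square)
    show ?thesis unfolding cancel by (simp add: algebra_simps)
  qed
  finally show ?thesis unfolding \<beta>_def .
qed

text \<open>
  In the decomposition of \<open>sum_pairs_split\<close> the correction for double coincidences is a sum of variances
  with a negative sign, so it can be dropped.
\<close>

lemma variance_off_diagonal_le:
  assumes sym: "\<And>i j. b i j = b j i" and diag: "\<And>i. b i i = 0"
  shows "variance (quad b n) \<le> (230 * Phi0 M X + 240 * Phi1 \<phi>) * (\<Sum>i<n. \<Sum>j<n. (b i j)^2)"
proof -
  have "variance (quad b n) = (\<Sum>i<n. \<Sum>j<n. \<Sum>k<n. \<Sum>l<n.
         if k \<notin> {i,j} \<and> l \<notin> {i,j} then b i j * b k l * pair_cov i j k l else 0)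
      + 4 * (\<Sum>i<n. \<Sum>j<n. \<Sum>l<n. b i j * b i l * pair_cov i j i l)
      - 2 * (\<Sum>i<n. \<Sum>j<n. (b i j)^2 * pair_cov i j i j)"
    unfolding variance_quad by (rule sum_pairs_split[OF _ sym diag pair_cov_swap(1,2)]) simp
  moreover have "(\<Sum>i<n. \<Sum>j<n. \<Sum>l<n. b i j * b i l * pair_cov i j i l)
      \<le> (\<Sum>i<n. (115 * Phi0 M X + 96 * Phi1 \<phi>) / 2 * (\<Sum>j<n. (b i j)^2))"
    by (intro sum_mono sum_shared_index_le)
  moreover have "\<dots> = (115 * Phi0 M X + 96 * Phi1 \<phi>) / 2 * (\<Sum>i<n. \<Sum>j<n. (b i j)^2)"
    by (rule sum_distrib_left[symmetric])
  moreover have "0 \<le> (\<Sum>i<n. \<Sum>j<n. (b i j)^2 * pair_cov i j i j)"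
    by (intro sum_nonneg mult_nonneg_nonneg pair_cov_self_nonneg) simp
  ultimately show ?thesis
    using sum_disjoint_pairs_le[of b n, OF diag] by (simp add: algebra_simps)
qed

lemma Phi2_nonneg: "0 \<le> Phi2 \<psi>"
  unfolding Phi2_def by (intro suminf_nonneg Phi2_finite psi_nonneg) auto

lemma sum_psi_le:
  assumes T: "finite T" and inj: "inj_on d T" and pos: "\<And>t. t \<in> T \<Longrightarrow> 1 \<le> d t"
  shows "(\<Sum>t\<in>T. \<psi> (d t)) \<le> Phi2 \<psi>"
proof -
  have "(\<Sum>t\<in>T. \<psi> (d t)) = (\<Sum>t\<in>T. \<psi> (Suc (d t - 1)))"
    by (intro sum.cong refl arg_cong[where f = \<psi>]) (use pos in fastforce)
  also have "\<dots> = (\<Sum>m\<in>(\<lambda>t. d t - 1) ` T. \<psi> (Suc m))"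
  proof (rule sum.reindex_cong[symmetric])
    show "inj_on (\<lambda>t. d t - 1) T"
    proof (rule inj_onI)
      fix s t assume "s \<in> T" "t \<in> T" "d s - 1 = d t - 1"
      then have "d s = d t" using pos[of s] pos[of t] by linarith
      then show "s = t" using inj \<open>s \<in> T\<close> \<open>t \<in> T\<close> by (auto dest: inj_onD)
    qed
  qed auto
  also have "\<dots> \<le> Phi2 \<psi>"
    unfolding Phi2_def by (intro sum_le_suminf Phi2_finite) (auto intro: T psi_nonneg)
  finally show ?thesis .
qed

lemma pair_cov_squares_le: "i < k \<Longrightarrow> pair_cov i i k k \<le> \<psi> (k - i)"
  using cov_squares[of "Suc i" "Suc k"]
  by (simp add: covariance_eq power2_eq_square integrable_prod2 integrable_prod4 pair_cov_def m2_def m4_def)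

text \<open>
  Covariances of squares may be very negative, so the bound rests on the products \<open>c i * c k\<close> being
  non-negative.
\<close>

lemma variance_diagonal_le:
  assumes c: "\<And>i. 0 \<le> c i"
  shows "variance (quad (\<lambda>i j. if i = j then c i else 0) n) \<le> (Phi0 M X + 2 * Phi2 \<psi>) * (\<Sum>i<n. (c i)^2)"
proof -
  define w where "w i k = (if i = k then Phi0 M X else 0) + (if k < i then \<psi> (i - k) else 0)
       + (if i < k then \<psi> (k - i) else 0)" for i k
  have wsum: "(\<Sum>k<n. w i k) \<le> Phi0 M X + 2 * Phi2 \<psi>" for i
  proof -
    have "(\<Sum>k<n. if i = k then Phi0 M X else 0) \<le> Phi0 M X" using Phi0_nonneg by simp
    moreover have "(\<Sum>k<n. if k < i then \<psi> (i - k) else 0) = (\<Sum>k\<in>{k\<in>{..<n}. k < i}. \<psi> (i - k))"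
      by (rule sum.inter_filter[symmetric]) simp
    moreover have "\<dots> \<le> Phi2 \<psi>" by (rule sum_psi_le) (auto simp: inj_on_def)
    moreover have "(\<Sum>k<n. if i < k then \<psi> (k - i) else 0) = (\<Sum>k\<in>{k\<in>{..<n}. i < k}. \<psi> (k - i))"
      by (rule sum.inter_filter[symmetric]) simp
    moreover have "\<dots> \<le> Phi2 \<psi>" by (rule sum_psi_le) (auto simp: inj_on_def)
    ultimately show ?thesis unfolding w_def sum.distrib by linarith
  qed
  have wsym: "w i k = w k i" for i k by (auto simp: w_def)
  have wle: "pair_cov i i k k \<le> w i k" for i k
  proof (cases i k rule: linorder_cases)
    case equal
    have "pair_cov i i i i \<le> m4 i i i i" by (simp add: pair_cov_def)
    with equal show ?thesis using m4_squares_le_Phi0[of i i] by (simp add: w_def)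
  qed (use pair_cov_squares_le[of i k] pair_cov_squares_le[of k i] in
        \<open>simp_all add: w_def pair_cov_swap(3)[of i i k k]\<close>)
  have w0: "0 \<le> w i k" for i k
    by (cases i k rule: linorder_cases) (auto simp: w_def Phi0_nonneg intro!: psi_nonneg)
  let ?d = "\<lambda>i j. if i = j then c i else 0"
  have "?d i j * ?d k l * pair_cov i j k l
     = (if j = i then if l = k then c i * c k * pair_cov i i k k else 0 else 0)" for i j k l
    by auto
  then have "variance (quad ?d n) = (\<Sum>i<n. \<Sum>j<n. \<Sum>k<n. \<Sum>l<n.
      if j = i then if l = k then c i * c k * pair_cov i i k k else 0 else 0)"
    unfolding variance_quad by (simp only:)
  also have "\<dots> = (\<Sum>i<n. \<Sum>j<n. if j = i then \<Sum>k<n. c i * c k * pair_cov i i k k else 0)"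
    by (intro sum.cong refl) simp
  also have "\<dots> = (\<Sum>i<n. \<Sum>k<n. c i * c k * pair_cov i i k k)"
    by (rule sum.cong[OF refl]) simp
  also have "\<dots> \<le> (\<Sum>i<n. \<Sum>k<n. ((c i)^2 * w i k + (c k)^2 * w i k) / 2)"
  proof (intro sum_mono)
    fix i k
    have "c i * c k * pair_cov i i k k \<le> c i * c k * w i k"
      by (intro mult_left_mono wle mult_nonneg_nonneg c)
    also have "\<dots> \<le> ((c i)^2 + (c k)^2) / 2 * w i k"
      using sum_squares_bound[of "c i" "c k"] by (intro mult_right_mono w0) simp
    finally show "c i * c k * pair_cov i i k k \<le> ((c i)^2 * w i k + (c k)^2 * w i k) / 2"
      by (simp add: algebra_simps)
  qed
  also have "\<dots> = ((\<Sum>i<n. \<Sum>k<n. (c i)^2 * w i k) + (\<Sum>i<n. \<Sum>k<n. (c k)^2 * w i k)) / 2"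
    by (simp add: sum.distrib sum_divide_distrib add_divide_distrib)
  also have "(\<Sum>i<n. \<Sum>k<n. (c k)^2 * w i k) = (\<Sum>i<n. \<Sum>k<n. (c i)^2 * w i k)"
    by (subst sum.swap) (simp add: wsym)
  also have "(\<Sum>i<n. \<Sum>k<n. (c i)^2 * w i k) = (\<Sum>i<n. (c i)^2 * (\<Sum>k<n. w i k))"
    by (simp add: sum_distrib_left)
  finally have "variance (quad ?d n) \<le> (\<Sum>i<n. (c i)^2 * (\<Sum>k<n. w i k))" by simp
  also have "\<dots> \<le> (\<Sum>i<n. (c i)^2 * (Phi0 M X + 2 * Phi2 \<psi>))"
    by (intro sum_mono mult_left_mono wsum) simp
  finally show ?thesis
    unfolding sum_distrib_right[symmetric] by (simp add: mult.commute)
qed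

text \<open>
  The two parts of the form contribute \<open>2 * (230 * \<Phi>\<^sub>0 + 240 * \<Phi>\<^sub>1)\<close> and \<open>4 * (\<Phi>\<^sub>0 + 2 * \<Phi>\<^sub>2)\<close>; the largest
  total coefficient, that of \<open>\<Phi>\<^sub>1\<close>, serves as the constant.
\<close>

lemma variance_quad_le:
  "variance (quad a n) \<le> 480 * (Phi0 M X + Phi1 \<phi> + Phi2 \<psi>) * (\<Sum>i<n. \<Sum>j<n. (a i j)^2)"
proof -
  define F where "F = (\<Sum>i<n. \<Sum>j<n. (a i j)^2)"
  define b where "b i j = (if i = j then 0 else (a i j + a j i) / 2)" for i j
  define p where "p i = max (a i i) 0" for i
  define q where "q i = max (- a i i) 0" for i
  let ?P = "quad (\<lambda>i j. if i = j then p i else 0) n"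
  let ?Q = "quad (\<lambda>i j. if i = j then q i else 0) n"
  let ?R = "quad (\<lambda>i j. - (if i = j then q i else 0)) n"
  let ?D = "quad (\<lambda>i j. (if i = j then p i else 0) + - (if i = j then q i else 0)) n"
  have lin: "quad (\<lambda>i j. u i j + v i j) n = (\<lambda>\<omega>. quad u n \<omega> + quad v n \<omega>)" for u v
    by (rule ext) (simp add: quad_def sum.distrib distrib_right)
  have transp: "quad (\<lambda>i j. a j i) n = quad a n"
    unfolding quad_def by (rule ext, subst sum.swap) (simp add: mult.commute)
  have "b i j + ((if i = j then p i else 0) + - (if i = j then q i else 0)) = a i j / 2 + a j i / 2" for i j
    by (auto simp: b_def p_def q_def add_divide_distrib)
  then have "(\<lambda>\<omega>. quad b n \<omega> + ?D \<omega>) = quad (\<lambda>i j. a i j / 2 + a j i / 2) n"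
    by (simp only: lin[symmetric])
  also have "\<dots> = quad a n"
    unfolding lin using transp
    by (auto simp: fun_eq_iff quad_def sum_divide_distrib[symmetric])
  finally have split: "(\<lambda>\<omega>. quad b n \<omega> + ?D \<omega>) = quad a n" .
  have "variance (quad a n) = variance (\<lambda>\<omega>. quad b n \<omega> + ?D \<omega>)"
    by (simp only: fun_cong[OF split])
  also have "\<dots> \<le> 2 * variance (quad b n) + 2 * variance ?D"
    by (rule variance_quad_add)
  also have "variance ?D \<le> 2 * variance ?P + 2 * variance ?R"
    unfolding lin by (rule variance_quad_add)
  also have "variance ?R = variance ?Q"
    unfolding variance_quad by (simp only: minus_mult_minus)
  finally have "variance (quad a n) \<le> 2 * variance (quad b n) + 4 * variance ?P + 4 * variance ?Q" by simp
  moreover have "variance (quad b n) \<le> (230 * Phi0 M X + 240 * Phi1 \<phi>) * (\<Sum>i<n. \<Sum>j<n. (b i j)^2)"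
    by (rule variance_off_diagonal_le) (auto simp: b_def)
  moreover have "\<dots> \<le> (230 * Phi0 M X + 240 * Phi1 \<phi>) * F"
  proof (rule mult_left_mono)
    have "(\<Sum>i<n. \<Sum>j<n. (b i j)^2) \<le> (\<Sum>i<n. \<Sum>j<n. ((a i j)^2 + (a j i)^2) / 2)"
    proof (intro sum_mono)
      fix i j
      have "0 \<le> (a i j - a j i)^2" by simp
      then show "(b i j)^2 \<le> ((a i j)^2 + (a j i)^2) / 2"
        by (simp add: b_def power_divide power2_sum power2_diff)
    qed
    also have "\<dots> = (F + (\<Sum>i<n. \<Sum>j<n. (a j i)^2)) / 2"
      by (simp add: F_def sum.distrib sum_divide_distrib add_divide_distrib)
    also have "(\<Sum>i<n. \<Sum>j<n. (a j i)^2) = F" unfolding F_def by (rule sum.swap)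
    finally show "(\<Sum>i<n. \<Sum>j<n. (b i j)^2) \<le> F" by simp
  qed (use Phi0_nonneg Phi1_nonneg in simp)
  moreover have "variance ?P \<le> (Phi0 M X + 2 * Phi2 \<psi>) * (\<Sum>i<n. (p i)^2)"
    "variance ?Q \<le> (Phi0 M X + 2 * Phi2 \<psi>) * (\<Sum>i<n. (q i)^2)"
    by (rule variance_diagonal_le; simp add: p_def q_def)+
  moreover have "(Phi0 M X + 2 * Phi2 \<psi>) * (\<Sum>i<n. (p i)^2) + (Phi0 M X + 2 * Phi2 \<psi>) * (\<Sum>i<n. (q i)^2)
     \<le> (Phi0 M X + 2 * Phi2 \<psi>) * F"
    unfolding distrib_left[symmetric]
  proof (rule mult_left_mono)
    have "(\<Sum>i<n. (p i)^2) + (\<Sum>i<n. (q i)^2) = (\<Sum>i<n. (a i i)^2)"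
      unfolding sum.distrib[symmetric] by (intro sum.cong refl) (auto simp: p_def q_def max_def)
    also have "\<dots> \<le> F"
      unfolding F_def by (intro sum_mono member_le_sum[of _ _ "\<lambda>j. (a i j)^2" for i]) auto
    finally show "(\<Sum>i<n. (p i)^2) + (\<Sum>i<n. (q i)^2) \<le> F" .
  qed (use Phi0_nonneg Phi2_nonneg in simp)
  moreover have "2 * ((230 * Phi0 M X + 240 * Phi1 \<phi>) * F) + 4 * ((Phi0 M X + 2 * Phi2 \<psi>) * F)
      \<le> 480 * (Phi0 M X + Phi1 \<phi> + Phi2 \<psi>) * F"
  proof -
    have "0 \<le> F" unfolding F_def by (intro sum_nonneg) simp
    then have "0 \<le> (16 * Phi0 M X + 472 * Phi2 \<psi>) * F"
      using Phi0_nonneg Phi2_nonneg by (intro mult_nonneg_nonneg) auto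
    then show ?thesis by (simp add: algebra_simps)
  qed
  ultimately show ?thesis unfolding F_def[symmetric] by linarith
qed

end

section \<open>Quadratic forms given by matrices\<close>

lemma trace_mult_transpose:
  fixes A :: "real mat"
  assumes "A \<in> carrier_mat p p"
  shows "mat_trace (A * A\<^sup>T) = (\<Sum>i<p. \<Sum>j<p. (A $$ (i, j))^2)"
  using assms by (auto simp: mat_trace_def scalar_prod_def power2_eq_square lessThan_atLeast0 intro!: sum.cong)

lemma quad_form_sample_vec:
  assumes "A \<in> carrier_mat p p"
  shows "quad_form A (sample_vec X p \<omega>)
    = (\<Sum>i<p. \<Sum>j<p. A $$ (i, j) * (X (Suc i) \<omega> * X (Suc j) \<omega>))"
  using assms by (auto simp: quad_form_def sample_vec_def scalar_prod_def lessThan_atLeast0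
      sum_distrib_left ac_simps intro!: sum.cong)

lemma variance_bound_480: "variance_bound TYPE('a) 480"
  unfolding variance_bound_def
proof (intro allI impI ballI)
  fix M :: "'a measure" and X \<phi> \<psi> p and A :: "real mat"
  assume "weakly_dependent_sequence M X \<phi> \<psi>" and A: "A \<in> carrier_mat p p"
  then interpret weakly_dependent_sequence M X \<phi> \<psi> by simp
  have "quad_form A (sample_vec X p \<omega>) = quad (\<lambda>i j. A $$ (i, j)) p \<omega>" for \<omega>
    unfolding quad_form_sample_vec[OF A] quad_def ..
  then show "prob_space.variance M (\<lambda>\<omega>. quad_form A (sample_vec X p \<omega>))
      \<le> 480 * (Phi0 M X + Phi1 \<phi> + Phi2 \<psi>) * mat_trace (A * A\<^sup>T)"
    using variance_quad_le[of "\<lambda>i j. A $$ (i, j)" p] by (simp add: trace_mult_transpose[OF A])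
qed

section \<open>Independence of the sample space\<close>

text \<open>
  The law of the sequence, on the space of real sequences, carries all the hypotheses, because
  they only involve integrals of measurable functions of the \<open>X k\<close> with \<open>1 \<le> k\<close>. The coordinate 0 is set
  to 0 because \<open>X 0\<close> need not be measurable.
\<close>

lemma weakly_dependent_sequence_distr:
  fixes M :: "'a measure"
  assumes wds: "weakly_dependent_sequence M X \<phi> \<psi>"
  defines "T \<equiv> \<lambda>\<omega> k. if k = 0 then 0 else X k \<omega>"
  defines "N \<equiv> distr M (PiM UNIV (\<lambda>_. borel)) T"
  shows "weakly_dependent_sequence N (\<lambda>k x. x k) \<phi> \<psi>"
    and "Phi0 N (\<lambda>k x. x k) = Phi0 M X"
    and "A \<in> carrier_mat p p \<Longrightarrow> prob_space.variance N (\<lambda>x. quad_form A (sample_vec (\<lambda>k x. x k) p x))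
      = prob_space.variance M (\<lambda>\<omega>. quad_form A (sample_vec X p \<omega>))"
proof -
  interpret weakly_dependent_sequence M X \<phi> \<psi> by (rule wds)
  have T [measurable]: "T \<in> measurable M (PiM UNIV (\<lambda>_. borel))"
  proof (rule measurable_PiM_single')
    fix k show "(\<lambda>\<omega>. T \<omega> k) \<in> borel_measurable M"
      using rv[of k] by (cases "k = 0") (simp_all add: T_def)
  qed simp
  have coord [measurable]: "(\<lambda>x. x k) \<in> borel_measurable (PiM UNIV (\<lambda>_. borel))" for k :: nat
    by (rule measurable_component_singleton) simp
  have Tk: "T \<omega> k = X k \<omega>" if "1 \<le> k" for \<omega> k using that by (simp add: T_def)
  have int: "(\<integral>x. f x \<partial>N) = (\<integral>\<omega>. f (T \<omega>) \<partial>M)"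
    if "f \<in> borel_measurable (PiM UNIV (\<lambda>_. borel))" for f :: "(nat \<Rightarrow> real) \<Rightarrow> real"
    unfolding N_def by (rule integral_distr[OF T that])
  have integ: "integrable N f \<longleftrightarrow> integrable M (\<lambda>\<omega>. f (T \<omega>))"
    if "f \<in> borel_measurable (PiM UNIV (\<lambda>_. borel))" for f :: "(nat \<Rightarrow> real) \<Rightarrow> real"
    unfolding N_def by (rule integrable_distr_eq[OF T that])
  have cov: "covariance N U V = covariance M (\<lambda>\<omega>. U (T \<omega>)) (\<lambda>\<omega>. V (T \<omega>))"
    if [measurable]: "U \<in> borel_measurable (PiM UNIV (\<lambda>_. borel))"
      "V \<in> borel_measurable (PiM UNIV (\<lambda>_. borel))" for U V :: "(nat \<Rightarrow> real) \<Rightarrow> real"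
    unfolding covariance_def by (subst (1 2 3) int) measurable
  have N: "prob_space N" unfolding N_def by (rule prob_space_distr[OF T])
  show "weakly_dependent_sequence N (\<lambda>k x. x k) \<phi> \<psi>"
  proof (intro weakly_dependent_sequence.intro N weakly_dependent_sequence_axioms.intro)
    show "(\<lambda>x. x k) \<in> borel_measurable N" for k by (simp add: N_def coord)
    show "bdd_above ((\<lambda>k. integral\<^sup>L N (\<lambda>x. x k ^ 4)) ` {1..})"
    proof -
      have "(\<lambda>k. integral\<^sup>L N (\<lambda>x. x k ^ 4)) ` {1..} = (\<lambda>k. expectation (\<lambda>\<omega>. X k \<omega> ^ 4)) ` {1..}"
        by (intro image_cong refl) (simp add: int Tk)
      then show ?thesis using Phi0_finite by (simp only:)
    qed
  qed (simp_all add: int integ cov Tk mean_integrable centred square_integrable second_moment fourth_moment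
      phi_nonneg phi_antimono psi_nonneg cov_1_3 cov_3_1 cov_2_2 cov_1_1 cov_squares
      Phi1_finite[unfolded of_nat_Suc] Phi2_finite)
  show "Phi0 N (\<lambda>k x. x k) = Phi0 M X"
    unfolding Phi0_def by (intro SUP_cong refl) (simp add: int Tk)
  have e: "sample_vec (\<lambda>k x. x k) p (T \<omega>) = sample_vec X p \<omega>" for \<omega>
    by (simp add: sample_vec_def Tk)
  assume A: "A \<in> carrier_mat p p"
  have q [measurable]: "(\<lambda>x. quad_form A (sample_vec (\<lambda>k x. x k) p x)) \<in> borel_measurable (PiM UNIV (\<lambda>_. borel))"
    unfolding quad_form_sample_vec[OF A] by measurable
  have "prob_space.variance N (\<lambda>x. quad_form A (sample_vec (\<lambda>k x. x k) p x))
      = expectation (\<lambda>\<omega>. (quad_form A (sample_vec (\<lambda>k x. x k) p (T \<omega>))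
          - expectation (\<lambda>\<omega>. quad_form A (sample_vec (\<lambda>k x. x k) p (T \<omega>))))^2)"
    unfolding int[OF q] by (rule int) measurable
  then show "prob_space.variance N (\<lambda>x. quad_form A (sample_vec (\<lambda>k x. x k) p x))
      = prob_space.variance M (\<lambda>\<omega>. quad_form A (sample_vec X p \<omega>))"
    unfolding e .
qed

theorem theorem2p2:
  "(\<exists>C>0. variance_bound TYPE(nat \<Rightarrow> real) C) \<and>
   (\<forall>C. variance_bound TYPE(nat \<Rightarrow> real) C \<longrightarrow> variance_bound TYPE('a) C)"
proof (intro conjI allI impI)
  show "\<exists>C>0. variance_bound TYPE(nat \<Rightarrow> real) C"
    using variance_bound_480 by (intro exI[of _ 480]) simp
next
  fix C assume "variance_bound TYPE(nat \<Rightarrow> real) C"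
  then show "variance_bound TYPE('a) C"
    unfolding variance_bound_def
  proof (intro allI impI ballI)
    fix M :: "'a measure" and X \<phi> \<psi> p and A :: "real mat"
    assume C: "\<forall>(M :: (nat \<Rightarrow> real) measure) X \<phi> \<psi>. weakly_dependent_sequence M X \<phi> \<psi> \<longrightarrow>
       (\<forall>p\<ge>1. \<forall>A \<in> carrier_mat p p.
          prob_space.variance M (\<lambda>\<omega>. quad_form A (sample_vec X p \<omega>))
            \<le> C * (Phi0 M X + Phi1 \<phi> + Phi2 \<psi>) * mat_trace (A * A\<^sup>T))"
      and w: "weakly_dependent_sequence M X \<phi> \<psi>" and p: "1 \<le> p" and A: "A \<in> carrier_mat p p"
    note law = weakly_dependent_sequence_distr[OF w]
    show "prob_space.variance M (\<lambda>\<omega>. quad_form A (sample_vec X p \<omega>))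
        \<le> C * (Phi0 M X + Phi1 \<phi> + Phi2 \<psi>) * mat_trace (A * A\<^sup>T)"
      using C[rule_format, OF law(1) p A] unfolding law(2) law(3)[OF A] .
  qed
qed

end
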